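(* On the curve $\mathcal{X}_{a,b,n,1}$, let $P_1$ and $P_2$ be two (distinct) totally ramified rational points that are different from $P_\infty$. Let $\alpha\in\{0,\ldots,\frac{q^2}{p^b}-3\}$ and $\beta\in\{0,1\}$. For $n\geq 5$, if $$n_1:=(\beta+1)q^{n-3}(q^2-q+1)+\alpha(q^n+1)$$ and $$n_2:=\Big(\frac{q^2}{p^b}-3\Big)(q^n+1)+3q^{n-3}(q^2-q+1)-(\beta+1)q^{n-3}(q^2-q+1)-\alpha(q^n+1),$$ then the pair $(n_1,n_2)$ is a pure gap at $(P_1,P_2)$.
   Context: Let $p$ be a prime, $a,b\geq 1$ with $b\mid a$, $q=p^a$, $n\ge 3$ odd, $c\in\mathbb{F}_{q^2}$ with $c^{q-1}=-1$, and $M=\frac{q^n+1}{q+1}$. $\mathcal{X}_{a,b,n,1}$ is the nonsingular, projective, absolutely irreducible curve over $\mathbb{F}_{q^{2n}}$ given by $c\,y^{q+1}=t(x):=\sum_{i=0}^{a/b-1}x^{p^{ib}}$ and $z^M=y^{q^2}-y$; it has the plane model $c\,z^{q^n+1}=t(x)\big(t(x)^{q-1}+1\big)^{q+1}$. $P_\infty$ is the unique common pole of $x,y,z$. "Totally ramified" means totally ramified in the Kummer extension of degree $q^n+1$ of the rational function field in $x$ given by this plane model; the totally ramified points other than $P_\infty$ are the points lying over the zeros of $t(x)$. For a divisor $D$, $\ell(D)=\dim\mathcal{L}(D)$. A tuple $(n_1,\ldots,n_s)\in\mathbb{N}_0^s$ is a pure gap at distinct rational points $(P_1,\ldots,P_s)$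 if $\ell\big(\sum_{i=1}^s n_iP_i-P_j\big)=\ell\big(\sum_{i=1}^s n_iP_i\big)$ for every $j\in\{1,\ldots,s\}$; equivalently $\ell\big(\sum_i n_iP_i\big)=\ell\big(\sum_i (n_i-1)P_i\big)$. *)

theory Defs
  imports
    "HOL-Computational_Algebra.Polynomial"
    "HOL-Computational_Algebra.Primes"
    "HOL-Library.Cardinality"
    "HOL-Library.Poly_Mapping"
begin

text \<open>
  A nonsingular projective curve over a field \<open>K\<close> is represented by its function field \<open>F/K\<close>:
  \<open>K\<close> and \<open>F\<close> are the types \<open>'k\<close> and \<open>'f\<close>, with \<open>K\<close> embedded in \<open>F\<close> by \<open>emb\<close>.
  Points are places.
\<close>

definition field_embedding :: "('k::field \<Rightarrow> 'f::field) \<Rightarrow> bool" where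
  "field_embedding emb \<longleftrightarrow>
     emb 1 = 1 \<and>
     (\<forall>u v. emb (u + v) = emb u + emb v) \<and>
     (\<forall>u v. emb (u * v) = emb u * emb v)"

definition is_subfield :: "'f::field set \<Rightarrow> bool" where
  "is_subfield E \<longleftrightarrow>
     1 \<in> E \<and> (\<forall>f\<in>E. \<forall>g\<in>E. f - g \<in> E \<and> f * g \<in> E) \<and> (\<forall>f\<in>E. inverse f \<in> E)"

definition adjoin :: "('k::field \<Rightarrow> 'f::field) \<Rightarrow> 'f set \<Rightarrow> 'f set" where
  "adjoin emb S = is_subfield hull (range emb \<union> S)"

definition transcendental :: "('k::field \<Rightarrow> 'f::field) \<Rightarrow> 'f \<Rightarrow> bool" where
  "transcendental emb x \<longleftrightarrow> (\<forall>r :: 'k poly. r \<noteq> 0 \<longrightarrow> poly (map_poly emb r) x \<noteq> 0)"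

text \<open>
  A place of an intermediate field \<open>E\<close> of \<open>F/K\<close> is given by its normalized discrete valuation,
  trivial on \<open>K\<close>.  The value at \<open>0\<close> (which should be infinite) and the values outside \<open>E\<close>
  are set to \<open>0\<close>, so that different functions are different places.
\<close>

definition is_place :: "('k::field \<Rightarrow> 'f::field) \<Rightarrow> 'f set \<Rightarrow> ('f \<Rightarrow> int) \<Rightarrow> bool" where
  "is_place emb E P \<longleftrightarrow>
     P 0 = 0 \<and> (\<forall>f. f \<notin> E \<longrightarrow> P f = 0) \<and>
     (\<forall>k. k \<noteq> 0 \<longrightarrow> P (emb k) = 0) \<and>
     (\<forall>f\<in>E - {0}. \<forall>g\<in>E - {0}. P (f * g) = P f + P g) \<and>
     (\<forall>f\<in>E - {0}. \<forall>g\<in>E - {0}. f + g \<noteq> 0 \<longrightarrow> min (P f) (P g) \<le> P (f + g)) \<and>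
     (\<exists>f\<in>E - {0}. P f = 1)"

abbreviation point :: "('k::field \<Rightarrow> 'f::field) \<Rightarrow> ('f \<Rightarrow> int) \<Rightarrow> bool" where
  "point emb P \<equiv> is_place emb UNIV P"

text \<open>A point is rational if its residue field is \<open>K\<close>.\<close>

definition rational_point :: "('k::field \<Rightarrow> 'f::field) \<Rightarrow> ('f \<Rightarrow> int) \<Rightarrow> bool" where
  "rational_point emb P \<longleftrightarrow>
     point emb P \<and>
     (\<forall>f. f \<noteq> 0 \<and> 0 \<le> P f \<longrightarrow> (\<exists>k. f = emb k \<or> 0 < P (f - emb k)))"

text \<open>\<open>P\<close> has ramification index \<open>e\<close> over the place \<open>Q\<close> of \<open>E\<close> below it.\<close>

definition has_ramification_index ::
  "('k::field \<Rightarrow> 'f::field) \<Rightarrow> 'f set \<Rightarrow> ('f \<Rightarrow> int) \<Rightarrow> nat \<Rightarrow> bool" where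
  "has_ramification_index emb E P e \<longleftrightarrow>
     0 < e \<and> (\<exists>Q. is_place emb E Q \<and> (\<forall>f\<in>E. P f = int e * Q f))"

type_synonym 'f divisor = "('f \<Rightarrow> int) \<Rightarrow>\<^sub>0 int"

definition riemann_roch_space ::
  "('k::field \<Rightarrow> 'f::field) \<Rightarrow> 'f divisor \<Rightarrow> 'f set" where
  "riemann_roch_space emb D =
     {f. f = 0 \<or> (\<forall>P. point emb P \<longrightarrow> - Poly_Mapping.lookup D P \<le> P f)}"

definition ell :: "('k::field \<Rightarrow> 'f::field) \<Rightarrow> 'f divisor \<Rightarrow> nat" where
  "ell emb D = vector_space.dim (\<lambda>k f. emb k * f) (riemann_roch_space emb D)"

definition divisor_of :: "nat list \<Rightarrow> ('f \<Rightarrow> int) list \<Rightarrow> 'f divisor" where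
  "divisor_of ns Ps = (\<Sum>i<length Ps. Poly_Mapping.single (Ps ! i) (int (ns ! i)))"

definition pure_gap ::
  "('k::field \<Rightarrow> 'f::field) \<Rightarrow> nat list \<Rightarrow> ('f \<Rightarrow> int) list \<Rightarrow> bool" where
  "pure_gap emb ns Ps \<longleftrightarrow>
     length ns = length Ps \<and> distinct Ps \<and> (\<forall>P\<in>set Ps. rational_point emb P) \<and>
     (\<forall>j<length Ps.
        ell emb (divisor_of ns Ps - Poly_Mapping.single (Ps ! j) 1) = ell emb (divisor_of ns Ps))"

definition t_poly :: "nat \<Rightarrow> nat \<Rightarrow> nat \<Rightarrow> 'f::field \<Rightarrow> 'f" where
  "t_poly p a b x = (\<Sum>i<a div b. x ^ (p ^ (i * b)))"

text \<open>
  The curve \<open>X\<^bsub>a,b,n,1\<^esub>\<close>.  The constraints determine the function field up to isomorphism: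
  \<open>t\<close> has only simple zeros, so by the plane model \<open>z\<close> has degree \<open>q\<^sup>n + 1\<close> over \<open>K(x)\<close>,
  which is the largest possible value of \<open>[K(x,y,z) : K(x)]\<close>; by total ramification
  \<open>K\<close> is also the full constant field.  The condition \<open>c ^ q\<^sup>2 = c\<close> expresses that \<open>c\<close>
  lies in the subfield with \<open>q\<^sup>2\<close> elements.  Both divisions below are exact.
\<close>

locale curve_X =
  fixes p a b q n :: nat
    and emb :: "'k::field \<Rightarrow> 'f::field"
    and c :: 'k
    and x y z :: 'f
  assumes prime_p: "prime p"
    and a_pos: "1 \<le> a" and b_pos: "1 \<le> b" and b_dvd_a: "b dvd a"
    and q_eq: "q = p ^ a"
    and n_ge: "3 \<le> n" and n_odd: "odd n"
    and card_K: "CARD('k) = q ^ (2 * n)"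
    and c_mem: "c ^ (q\<^sup>2) = c" and c_pow: "c ^ (q - 1) = - 1"
    and emb: "field_embedding emb"
    and x_transcendental: "transcendental emb x"
    and generated: "adjoin emb {x, y, z} = UNIV"
    and eq_y: "emb c * y ^ (q + 1) = t_poly p a b x"
    and eq_z: "z ^ ((q ^ n + 1) div (q + 1)) = y ^ (q\<^sup>2) - y"

text \<open>The extension \<open>F/K(x)\<close> is a Kummer extension of degree \<open>q\<^sup>n + 1\<close>.\<close>

definition totally_ramified ::
  "nat \<Rightarrow> nat \<Rightarrow> ('k::field \<Rightarrow> 'f::field) \<Rightarrow> 'f \<Rightarrow> ('f \<Rightarrow> int) \<Rightarrow> bool" where
  "totally_ramified q n emb x P \<longleftrightarrow> has_ramification_index emb (adjoin emb {x}) P (q ^ n + 1)"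

definition common_pole ::
  "('k::field \<Rightarrow> 'f::field) \<Rightarrow> 'f \<Rightarrow> 'f \<Rightarrow> 'f \<Rightarrow> ('f \<Rightarrow> int) \<Rightarrow> bool" where
  "common_pole emb x y z P \<longleftrightarrow> point emb P \<and> P x < 0 \<and> P y < 0 \<and> P z < 0"

end

theory Submission imports Defs "HOL-Computational_Algebra.Fraction_Field" begin

text \<open>
  Put \<open>m = q ^ n + 1\<close>.  The function field \<open>F\<close> of the curve is the Kummer extension \<open>K(x, z)\<close> of \<open>K(x)\<close>
  with \<open>z ^ m = \<kappa> t s ^ (q + 1)\<close>, where \<open>s = t ^ (q - 1) + 1\<close> and \<open>\<kappa>\<close> is a constant; \<open>t\<close> and \<open>s\<close> are
  coprime and have only simple zeros.  The base field contains \<open>m\<close> roots of unity of order dividing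
  \<open>m\<close>, so the Galois group consists of the automorphisms multiplying \<open>z\<close> by one of them, and the
  divisor \<open>D = n1 P1 + n2 P2\<close> is invariant under it.  Averaging over the group
  (\<open>component_value_ge\<close>) splits the Riemann-Roch space of \<open>D\<close> into the pieces consisting of the
  functions \<open>g z ^ i\<close> with \<open>g\<close> in \<open>K(x)\<close> and \<open>i < m\<close>.

  It remains to see that no \<open>g z ^ i\<close> in the space has a pole of order exactly \<open>n1\<close> at \<open>P1\<close>, or exactly
  \<open>n2\<close> at \<open>P2\<close> (\<open>no_extremal_function\<close>); the two cases are symmetric.  At \<open>P1\<close>, the value of \<open>z\<close> is \<open>1\<close>
  and the values of \<open>g\<close> are multiples of \<open>m\<close>, so the pole order determines \<open>i\<close>.  Knowing \<open>i\<close>, the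
  conditions at \<open>P1\<close>, at \<open>P2\<close> and at the zeros of \<open>t\<close> and \<open>s\<close> bound the finite poles of \<open>g\<close>, with rounding
  to integers at each of them.  Multiplying \<open>g\<close> by a suitable polynomial \<open>L\<close> thus yields a function
  without finite poles, that is, a polynomial.  The condition at infinity, however, makes this
  polynomial vanish at infinity.

  The argument uses that a condition at all places of \<open>F\<close> bounds \<open>g\<close> at all places of \<open>K(x)\<close>, so
  there must be a place of \<open>F\<close> above each of these.  This is Chevalley's extension
  theorem (\<open>exists_valuation_ring\<close>), combined with the fact that in a finite extension of \<open>K(x)\<close> the
  valuation rings with nonconstant polynomials among their nonunits are discrete (\<open>exists_place\<close>).

  The independence of the monomials \<open>z ^ i\<close> is read off from their values at \<open>P_inf\<close>, where
  \<open>x\<close> has a pole and \<open>deg (t s ^ (q + 1))\<close> is prime to \<open>m\<close>.  The invariance of \<open>P1\<close> and \<open>P2\<close> comes from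
  the uniqueness of a place above a place that is totally ramified (\<open>totally_ramified_unique\<close>).  The
  invariance also shows that \<open>P1\<close> and \<open>P2\<close> lie above zeros of \<open>t\<close>, as \<open>y\<close> must vanish at an invariant
  rational point (\<open>ramified_point_zero_t\<close>).
\<close>

section \<open>Places and their valuations\<close>

locale place =
  fixes emb :: "'k::field \<Rightarrow> 'f::field" and P :: "'f \<Rightarrow> int"
  assumes point: "point emb P"
begin

lemma value_zero [simp]: "P 0 = 0"
  and value_const [simp]: "k \<noteq> 0 \<Longrightarrow> P (emb k) = 0"
  and value_mult: "f \<noteq> 0 \<Longrightarrow> g \<noteq> 0 \<Longrightarrow> P (f * g) = P f + P g"
  and value_add: "f \<noteq> 0 \<Longrightarrow> g \<noteq> 0 \<Longrightarrow> f + g \<noteq> 0 \<Longrightarrow> min (P f) (P g) \<le> P (f + g)"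
  and uniformizer: "\<exists>f. f \<noteq> 0 \<and> P f = 1"
  using point unfolding is_place_def by auto

lemma value_one [simp]: "P 1 = 0"
  using value_mult[of 1 1] by simp

lemma value_inverse: "f \<noteq> 0 \<Longrightarrow> P (inverse f) = - P f"
  using value_mult[of f "inverse f"] by simp

lemma value_divide: "f \<noteq> 0 \<Longrightarrow> g \<noteq> 0 \<Longrightarrow> P (f / g) = P f - P g"
  by (simp add: divide_inverse value_mult value_inverse)

lemma value_power: "f \<noteq> 0 \<Longrightarrow> P (f ^ i) = int i * P f"
  by (induction i) (auto simp: value_mult algebra_simps)

lemma value_uminus [simp]: "P (- f) = P f"
proof -
  have "2 * P (- 1) = 0"
    using value_mult[of "- 1" "- 1"] by simp
  then show ?thesis
    using value_mult[of "- 1" f] by (cases "f = 0") auto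
qed

lemma value_add_eq:
  assumes "f \<noteq> 0" "g = 0 \<or> P f < P g"
  shows "f + g \<noteq> 0 \<and> P (f + g) = P f"
proof (cases "g = 0")
  case False
  with assms have less: "P f < P g" by simp
  have nz: "f + g \<noteq> 0"
  proof
    assume "f + g = 0"
    then have "g = - f" by (simp add: eq_neg_iff_add_eq_0 add.commute)
    then show False using less by simp
  qed
  have "min (P (f + g)) (P (- g)) \<le> P (f + g + - g)"
    by (rule value_add) (use nz False assms in auto)
  then have "min (P (f + g)) (P g) \<le> P f" by simp
  moreover have "min (P f) (P g) \<le> P (f + g)"
    using value_add assms(1) False nz by blast
  ultimately show ?thesis using nz less by auto
qed (use assms in auto)

lemma value_sum_ge:
  assumes "finite I" "\<And>i. i \<in> I \<Longrightarrow> f i \<noteq> 0 \<Longrightarrow> v \<le> P (f i)" "(\<Sum>i\<in>I. f i) \<noteq> 0"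
  shows "v \<le> P (\<Sum>i\<in>I. f i)"
  using assms
proof (induction I rule: finite_induct)
  case (insert j I)
  show ?case
  proof (cases "f j = 0 \<or> (\<Sum>i\<in>I. f i) = 0")
    case True
    then show ?thesis using insert by auto
  next
    case False
    then have "v \<le> P (\<Sum>i\<in>I. f i)" "v \<le> P (f j)"
      using insert by auto
    then show ?thesis
      using value_add[of "f j" "\<Sum>i\<in>I. f i"] insert.prems insert.hyps False by fastforce
  qed
qed simp

text \<open>If the values of the nonzero summands are distinct, the smallest one cannot be cancelled.\<close>

lemma value_sum_distinct:
  assumes "finite I" "i0 \<in> I" "f i0 \<noteq> 0"
    and "\<And>i j. i \<in> I \<Longrightarrow> j \<in> I \<Longrightarrow> i \<noteq> j \<Longrightarrow> f i \<noteq> 0 \<Longrightarrow> f j \<noteq> 0 \<Longrightarrow> P (f i) \<noteq> P (f j)"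
  obtains i where "i \<in> I" "f i \<noteq> 0" "(\<Sum>i\<in>I. f i) \<noteq> 0" "P (\<Sum>i\<in>I. f i) = P (f i)"
    "\<And>j. j \<in> I \<Longrightarrow> f j \<noteq> 0 \<Longrightarrow> P (f i) \<le> P (f j)"
proof -
  define J where "J = {i\<in>I. f i \<noteq> 0}"
  have J: "finite J" "i0 \<in> J" using assms by (auto simp: J_def)
  obtain i where i: "i \<in> J" "\<And>j. j \<in> J \<Longrightarrow> P (f i) \<le> P (f j)"
  proof -
    have "Min ((\<lambda>i. P (f i)) ` J) \<in> (\<lambda>i. P (f i)) ` J"
      using J by (intro Min_in) auto
    then obtain i where "i \<in> J" "P (f i) = Min ((\<lambda>i. P (f i)) ` J)" by auto
    then show thesis using J by (intro that[of i]) auto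
  qed
  have split: "(\<Sum>i\<in>I. f i) = f i + (\<Sum>j\<in>I - {i}. f j)"
    using i assms(1) by (simp add: J_def sum.remove)
  have "(\<Sum>j\<in>I - {i}. f j) = 0 \<or> P (f i) + 1 \<le> P (\<Sum>j\<in>I - {i}. f j)"
  proof (rule disjCI)
    assume "\<not> P (f i) + 1 \<le> P (\<Sum>j\<in>I - {i}. f j)"
    moreover have "P (f i) + 1 \<le> P (f j)" if "j \<in> I - {i}" "f j \<noteq> 0" for j
    proof -
      have "j \<in> J" using that by (auto simp: J_def)
      then have "P (f i) \<le> P (f j)" by (rule i)
      moreover have "P (f i) \<noteq> P (f j)" using assms(4)[of i j] that i(1) by (auto simp: J_def)
      ultimately show ?thesis by simp
    qed
    ultimately show "(\<Sum>j\<in>I - {i}. f j) = 0"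
      using value_sum_ge[of "I - {i}" f "P (f i) + 1"] assms(1) by blast
  qed
  then have "f i + (\<Sum>j\<in>I - {i}. f j) \<noteq> 0 \<and> P (f i + (\<Sum>j\<in>I - {i}. f j)) = P (f i)"
    using i by (intro value_add_eq) (auto simp: J_def)
  then show ?thesis
    using that[of i] i split by (auto simp: J_def)
qed

end

section \<open>Evaluating polynomials along a field embedding\<close>

locale field_emb =
  fixes emb :: "'k::field \<Rightarrow> 'f::field"
  assumes emb: "field_embedding emb"
begin

lemma emb_one [simp]: "emb 1 = 1"
  and emb_add: "emb (u + v) = emb u + emb v"
  and emb_mult: "emb (u * v) = emb u * emb v"
  using emb by (auto simp: field_embedding_def)

lemma emb_zero [simp]: "emb 0 = 0"
proof -
  have "emb 0 + emb 0 = emb 0 + 0" by (simp flip: emb_add)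
  then show ?thesis by (simp only: add_left_cancel)
qed

lemma emb_eq_0_iff [simp]: "emb u = 0 \<longleftrightarrow> u = 0"
  using emb_mult[of u "inverse u"] by (cases "u = 0") auto

lemma emb_uminus: "emb (- u) = - emb u"
  using emb_add[of "- u" u] by (simp add: eq_neg_iff_add_eq_0)

lemma emb_diff: "emb (u - v) = emb u - emb v"
  using emb_add[of u "- v"] by (simp add: emb_uminus)

lemma emb_power: "emb (u ^ i) = emb u ^ i"
  by (induction i) (auto simp: emb_mult)

lemma emb_inverse: "emb (inverse u) = inverse (emb u)"
  using emb_mult[of u "inverse u"] by (cases "u = 0") (auto simp: field_simps)

lemma emb_divide: "emb (u / v) = emb u / emb v"
  by (simp add: divide_inverse emb_mult emb_inverse)

lemma emb_eq_iff [simp]: "emb u = emb v \<longleftrightarrow> u = v"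
  using emb_eq_0_iff[of "u - v"] by (simp add: emb_diff)

lemma emb_sum: "emb (\<Sum>i\<in>I. f i) = (\<Sum>i\<in>I. emb (f i))"
  by (induction I rule: infinite_finite_induct) (auto simp: emb_add)

definition ev :: "'f \<Rightarrow> 'k poly \<Rightarrow> 'f" where
  "ev w r = poly (map_poly emb r) w"

lemma ev_zero [simp]: "ev w 0 = 0" and ev_one [simp]: "ev w 1 = 1"
  by (auto simp: ev_def)

lemma ev_pCons [simp]: "ev w (pCons u r) = emb u + w * ev w r"
  by (simp add: ev_def map_poly_pCons)

lemma ev_add: "ev w (r + s) = ev w r + ev w s"
  unfolding ev_def poly_add[symmetric]
  by (rule arg_cong[of _ _ "\<lambda>r. poly r w"], rule poly_eqI) (simp add: coeff_map_poly emb_add)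

lemma ev_smult: "ev w (smult u r) = emb u * ev w r"
  by (simp add: ev_def map_poly_smult emb_mult)

lemma ev_mult: "ev w (r * s) = ev w r * ev w s"
  by (induction r) (auto simp: ev_add ev_smult algebra_simps)

lemma ev_uminus: "ev w (- r) = - ev w r"
  using ev_add[of w "- r" r] by (simp add: eq_neg_iff_add_eq_0)

lemma ev_diff: "ev w (r - s) = ev w r - ev w s"
  using ev_add[of w r "- s"] by (simp add: ev_uminus)

lemma ev_power: "ev w (r ^ i) = ev w r ^ i"
  by (induction i) (auto simp: ev_mult)

lemma ev_monom: "ev w (monom u i) = emb u * w ^ i"
  by (simp add: ev_def map_poly_monom poly_monom)

lemma ev_sum: "ev w (\<Sum>i\<in>I. f i) = (\<Sum>i\<in>I. ev w (f i))"
  by (induction I rule: infinite_finite_induct) (auto simp: ev_add)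

lemma ev_altdef: "degree r < i \<Longrightarrow> ev w r = (\<Sum>j<i. emb (coeff r j) * w ^ j)"
proof -
  assume "degree r < i"
  then have "r = (\<Sum>j<i. monom (coeff r j) j)"
    by (intro poly_eqI) (simp add: coeff_sum coeff_monom if_distrib coeff_eq_0 cong: if_cong)
  then have "ev w r = ev w (\<Sum>j<i. monom (coeff r j) j)" by simp
  then show ?thesis by (simp add: ev_sum ev_monom)
qed

end

section \<open>Valuation rings\<close>

definition is_subring :: "'f::field set \<Rightarrow> bool" where
  "is_subring R \<longleftrightarrow> 1 \<in> R \<and> (\<forall>f\<in>R. \<forall>g\<in>R. f - g \<in> R \<and> f * g \<in> R)"

definition is_valuation_ring :: "'f::field set \<Rightarrow> bool" where
  "is_valuation_ring R \<longleftrightarrow> is_subring R \<and> (\<forall>f. f \<in> R \<or> inverse f \<in> R)"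

context
  fixes R :: "'f::field set"
  assumes R: "is_subring R"
begin

lemma subring_one: "1 \<in> R"
  and subring_diff: "f \<in> R \<Longrightarrow> g \<in> R \<Longrightarrow> f - g \<in> R"
  and subring_mult: "f \<in> R \<Longrightarrow> g \<in> R \<Longrightarrow> f * g \<in> R"
  using R by (auto simp: is_subring_def)

lemma subring_zero: "0 \<in> R"
  using subring_diff[OF subring_one subring_one] by simp

lemma subring_uminus: "f \<in> R \<Longrightarrow> - f \<in> R"
  using subring_diff[OF subring_zero, of f] by simp

lemma subring_add: "f \<in> R \<Longrightarrow> g \<in> R \<Longrightarrow> f + g \<in> R"
  using subring_diff[OF _ subring_uminus, of f g] by simp

lemma subring_power: "f \<in> R \<Longrightarrow> f ^ i \<in> R"
  by (induction i) (auto simp: subring_one subring_mult)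

lemma subring_sum: "(\<And>i. i \<in> I \<Longrightarrow> f i \<in> R) \<Longrightarrow> (\<Sum>i\<in>I. f i) \<in> R"
  by (induction I rule: infinite_finite_induct) (auto simp: subring_zero subring_add)

lemma subring_adjoin:
  "is_subring {poly r w | r. \<forall>i. coeff r i \<in> R}" (is "is_subring ?A")
  unfolding is_subring_def
proof (intro conjI ballI)
  show "1 \<in> ?A"
    by (auto intro!: exI[of _ 1] simp: subring_one subring_zero coeff_1)
next
  fix f g assume "f \<in> ?A" "g \<in> ?A"
  then obtain r s where rs: "f = poly r w" "g = poly s w"
    "\<forall>i. coeff r i \<in> R" "\<forall>i. coeff s i \<in> R" by auto
  show "f - g \<in> ?A"
    using rs by (auto intro!: exI[of _ "r - s"] simp: subring_diff)
  show "f * g \<in> ?A"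
    using rs by (auto intro!: exI[of _ "r * s"] subring_sum simp: subring_mult coeff_mult)
qed

lemma subset_subring_adjoin: "R \<subseteq> {poly r w | r. \<forall>i. coeff r i \<in> R}"
proof
  fix f assume "f \<in> R"
  then show "f \<in> {poly r w | r. \<forall>i. coeff r i \<in> R}"
    by (auto intro!: exI[of _ "[:f:]"] simp: coeff_pCons subring_zero split: nat.splits)
qed

lemma mem_subring_adjoin: "w \<in> {poly r w | r. \<forall>i. coeff r i \<in> R}"
  by (auto intro!: exI[of _ "[:0, 1:]"] simp: coeff_pCons subring_zero subring_one split: nat.splits)

text \<open>
  Solving \<open>b r(w) = 1\<close> for the constant term of \<open>r\<close> and multiplying by \<open>v ^ n\<close> shows that \<open>v ^ n\<close> is a
  combination of lower powers of \<open>v\<close>, which eliminates the leading term of \<open>s\<close>.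
\<close>

lemma lower_degree:
  assumes b: "b \<in> R" "inverse b \<notin> R"
    and units: "\<And>f. f \<in> R \<Longrightarrow> inverse (1 - b * f) \<in> R"
    and wv: "w * v = 1"
    and r: "\<And>i. coeff r i \<in> R" "b * poly r w = 1"
    and s: "\<And>i. coeff s i \<in> R" "degree r \<le> degree s"
  obtains s' where "degree s' < degree s" "\<And>i. coeff s' i \<in> R" "poly s' v = poly s v"
proof -
  have "b \<noteq> 0" using r by auto
  have "degree r \<noteq> 0"
  proof
    assume "degree r = 0"
    then obtain k where "r = [:k:]" by (metis degree_eq_zeroE)
    then have "inverse b = coeff r 0" using r(2) \<open>b \<noteq> 0\<close> by (simp add: field_simps)
    then show False using r(1) b by simp
  qed
  define u where "u = inverse (1 - b * coeff r 0)"
  have "u \<in> R" unfolding u_def using r(1) units by blast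
  have nz: "1 - b * coeff r 0 \<noteq> 0"
  proof
    assume "1 - b * coeff r 0 = 0"
    then have "inverse b = coeff r 0" using \<open>b \<noteq> 0\<close> by (simp add: field_simps)
    then show False using r(1) b by simp
  qed
  define n where "n = degree s"
  obtain r1 where r1: "r = pCons (coeff r 0) r1" by (metis coeff_pCons_0 pCons_cases)
  have "degree r1 < degree r"
    using \<open>degree r \<noteq> 0\<close> r1 by (metis degree_pCons_eq degree_pCons_0 lessI pCons_0_0)
  then have n: "degree r1 < n" using s by (simp add: n_def)
  have coeff_r1: "coeff r1 i \<in> R" for i
    using r(1) coeff_pCons_Suc[of "coeff r 0" r1 i] r1 by metis
  \<comment> \<open>Dividing the equation of \<open>r\<close> by \<open>1 - b r(0)\<close> expresses \<open>v ^ n\<close> by lower powers.\<close>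
  have "1 - b * coeff r 0 = b * w * poly r1 w"
    using r(2) by (subst (asm) r1) (simp add: algebra_simps)
  moreover have "u * (1 - b * coeff r 0) = 1"
    using nz unfolding u_def by simp
  ultimately have "u * (b * w * poly r1 w) = 1" by simp
  then have vn: "v ^ n = u * b * (w * v ^ n * poly r1 w)"
    by (simp add: algebra_simps)
  define k where "k = (\<Sum>i\<le>degree r1. monom (u * b * coeff r1 i) (n - 1 - i))"
  have wv_power: "w * v ^ n * w ^ i = v ^ (n - 1 - i)" if "i \<le> degree r1" for i
  proof -
    have "n = (n - 1 - i) + 1 + i" using that n by simp
    then have "v ^ n = v ^ (n - 1 - i) * v * v ^ i" by (metis power_add power_one_right)
    then have "w * v ^ n * w ^ i = v ^ (n - 1 - i) * (w * v) * (w * v) ^ i"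
      by (simp add: power_mult_distrib mult_ac)
    then show ?thesis using wv by simp
  qed
  have "w * v ^ n * poly r1 w = (\<Sum>i\<le>degree r1. coeff r1 i * (w * v ^ n * w ^ i))"
    by (simp add: poly_altdef sum_distrib_left mult_ac)
  also have "\<dots> = (\<Sum>i\<le>degree r1. coeff r1 i * v ^ (n - 1 - i))"
    by (intro sum.cong refl) (simp only: wv_power atMost_iff)
  finally have vn_k: "v ^ n = poly k v"
    using vn by (simp add: k_def poly_sum poly_monom sum_distrib_left mult_ac)
  have deg_k: "degree k \<le> n - 1"
    unfolding k_def by (intro degree_sum_le) (auto intro: order.trans[OF degree_monom_le])
  have coeff_k: "coeff k i \<in> R" for i
    unfolding k_def coeff_sum coeff_monom
    by (intro subring_sum) (auto simp: subring_zero \<open>u \<in> R\<close> b coeff_r1 subring_mult)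
  define s' where "s' = s - monom (coeff s n) n + smult (coeff s n) k"
  have "coeff s' i = 0" if "i \<ge> n" for i
    using that deg_k n by (cases "i = n") (auto simp: s'_def coeff_eq_0 n_def)
  then have "degree s' < n"
    using n by (metis degree_0 gr_implies_not0 leading_coeff_0_iff linorder_not_less neq0_conv)
  moreover have "coeff s' i \<in> R" for i
    using s coeff_k by (auto simp: s'_def intro!: subring_add subring_diff subring_mult subring_zero)
  moreover have "poly s' v = poly s v"
    by (simp add: s'_def poly_monom vn_k)
  ultimately show ?thesis using that n_def by blast
qed

text \<open>
  The descent behind Chevalley's extension theorem.  An equation for \<open>w\<close> and one for its inverse,
  both saying that \<open>b\<close> becomes a unit, can be played against each other: the one of smaller degree
  lowers the degree of the other, until one of them says that \<open>b\<close> is a unit of \<open>R\<close> itself.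
\<close>

lemma no_two_relations:
  assumes b: "b \<in> R" "inverse b \<notin> R"
    and units: "\<And>f. f \<in> R \<Longrightarrow> inverse (1 - b * f) \<in> R"
    and "w * v = 1"
    and "\<And>i. coeff r i \<in> R" "b * poly r w = 1"
    and "\<And>i. coeff s i \<in> R" "b * poly s v = 1"
  shows False
  using assms(4-)
proof (induction "degree r + degree s" arbitrary: r s rule: less_induct)
  case less
  show ?case
  proof (cases "degree r \<le> degree s")
    case True
    obtain s' where "degree s' < degree s" "\<And>i. coeff s' i \<in> R" "poly s' v = poly s v"
      using lower_degree[OF b units less.prems(1-4) True] by metis
    then show False using less.hyps[of r s'] less.prems by simp
  next
    case False
    then have le: "degree s \<le> degree r" by simp
    have vw: "v * w = 1" using less.prems(1) by (simp add: mult.commute)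
    obtain r' where "degree r' < degree r" "\<And>i. coeff r' i \<in> R" "poly r' w = poly r w"
      using lower_degree[OF b units vw less.prems(4,5,2) le] by metis
    then show False using less.hyps[of r' s] less.prems by simp
  qed
qed

end

lemma is_subfield_subring: "is_subfield E \<Longrightarrow> is_subring E"
  by (auto simp: is_subfield_def is_subring_def)

lemma (in field_emb) ev_in_subring:
  assumes "is_subring R" "range emb \<subseteq> R" "w \<in> R"
  shows "ev w r \<in> R"
proof (induction r)
  case (pCons k r)
  then have "emb k \<in> R" "w * ev w r \<in> R" using assms subring_mult by blast+
  then show ?case using subring_add assms(1) by simp
qed (simp add: subring_zero assms(1))

text \<open>
  A subring that is maximal among those in which \<open>b\<close> is not a unit is a valuation ring.  This yields
  a place at which \<open>b\<close> vanishes, without any knowledge of the integral closure.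
\<close>

theorem exists_valuation_ring:
  assumes "is_subring R0" "b \<in> R0" "inverse b \<notin> R0"
  obtains R where "is_valuation_ring R" "R0 \<subseteq> R" "inverse b \<notin> R"
proof -
  define X where "X = {R. is_subring R \<and> R0 \<subseteq> R \<and> inverse b \<notin> R}"
  have "\<exists>R\<in>X. \<forall>S\<in>X. R \<subseteq> S \<longrightarrow> S = R"
  proof (rule subset_Zorn_nonempty)
    show "X \<noteq> {}" using assms by (auto simp: X_def)
  next
    fix C assume C: "C \<noteq> {}" "subset.chain X C"
    then have sub: "S \<in> X" if "S \<in> C" for S
      using that by (auto simp: subset_chain_def)
    have "f - g \<in> \<Union>C \<and> f * g \<in> \<Union>C" if "f \<in> \<Union>C" "g \<in> \<Union>C" for f g
    proof -
      obtain S S' where S: "S \<in> C" "S' \<in> C" "f \<in> S" "g \<in> S'" using \<open>f \<in> _\<close> \<open>g \<in> _\<close> by auto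
      then have "S \<subseteq> S' \<or> S' \<subseteq> S" using C by (auto simp: subset_chain_def)
      then obtain S'' where "S'' \<in> C" "f \<in> S''" "g \<in> S''" using S by auto
      then show ?thesis using sub[of S''] by (auto simp: X_def is_subring_def)
    qed
    moreover have "1 \<in> \<Union>C" using C sub by (auto simp: X_def is_subring_def)
    moreover have "R0 \<subseteq> \<Union>C" using C sub by (auto simp: X_def)
    ultimately show "\<Union>C \<in> X"
      using sub by (auto simp: X_def is_subring_def)
  qed
  then obtain R where R: "is_subring R" "R0 \<subseteq> R" "inverse b \<notin> R"
    and max: "\<And>S. is_subring S \<Longrightarrow> inverse b \<notin> S \<Longrightarrow> R \<subseteq> S \<Longrightarrow> S = R"
    by (force simp: X_def)
  have "b \<in> R" using R assms by auto
  have "b \<noteq> 0" using \<open>b \<in> R\<close> R by auto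
  have adjoin_rel: "\<exists>r. (\<forall>i. coeff r i \<in> R) \<and> b * poly r w = 1" if "w \<notin> R" for w
  proof -
    have "inverse b \<in> {poly r w | r. \<forall>i. coeff r i \<in> R}"
      using max[OF subring_adjoin[OF R(1), of w]] subset_subring_adjoin[OF R(1), of w]
        mem_subring_adjoin[OF R(1), of w] that by blast
    then obtain r where "\<forall>i. coeff r i \<in> R" "inverse b = poly r w" by auto
    moreover have "b * inverse b = 1" using \<open>b \<noteq> 0\<close> by simp
    ultimately show ?thesis by (intro exI[of _ r]) simp
  qed
  have units: "inverse (1 - b * f) \<in> R" if "f \<in> R" for f
  proof (rule ccontr)
    define h where "h = 1 - b * f"
    assume "inverse (1 - b * f) \<notin> R"
    then obtain r where r: "\<forall>i. coeff r i \<in> R" "b * poly r (inverse h) = 1"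
      using adjoin_rel unfolding h_def by blast
    have "h \<in> R" using that R \<open>b \<in> R\<close> unfolding h_def by (auto simp: is_subring_def)
    have "h \<noteq> 0"
    proof
      assume "h = 0"
      then have "inverse b = f" using \<open>b \<noteq> 0\<close> by (simp add: h_def field_simps)
      then show False using that R by simp
    qed
    \<comment> \<open>Clearing denominators shows that a power of \<open>h\<close> lies in \<open>b R\<close>, but \<open>h\<close> is 1 modulo \<open>b R\<close>.\<close>
    define n where "n = degree r"
    have "h ^ n = b * (\<Sum>i\<le>n. coeff r i * h ^ (n - i))"
    proof -
      have "h ^ n = b * (poly r (inverse h) * h ^ n)" using r by (simp add: algebra_simps)
      also have "poly r (inverse h) * h ^ n = (\<Sum>i\<le>n. coeff r i * (inverse h ^ i * h ^ n))"
        by (simp add: poly_altdef n_def sum_distrib_left mult_ac)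
      also have "\<dots> = (\<Sum>i\<le>n. coeff r i * h ^ (n - i))"
        using \<open>h \<noteq> 0\<close> by (intro sum.cong refl) (auto simp: power_diff field_simps)
      finally show ?thesis .
    qed
    moreover have "(\<Sum>i\<le>n. coeff r i * h ^ (n - i)) \<in> R"
      using r \<open>h \<in> R\<close> by (intro subring_sum subring_mult subring_power R(1)) auto
    ultimately obtain s where s: "s \<in> R" "h ^ n = b * s" by blast
    have "\<exists>s'\<in>R. h ^ i = 1 - b * s'" for i
    proof (induction i)
      case 0
      show ?case using subring_zero[OF R(1)] by (intro bexI[of _ 0]) auto
    next
      case (Suc i)
      then obtain s' where s': "s' \<in> R" "h ^ i = 1 - b * s'" by auto
      have "h ^ Suc i = (1 - b * f) * (1 - b * s')"
        using s'(2) by (simp only: power_Suc) (simp only: h_def)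
      then have "h ^ Suc i = 1 - b * (s' + f - b * s' * f)"
        by (simp only:) (simp add: algebra_simps)
      moreover have "s' + f - b * s' * f \<in> R"
        using s' that \<open>b \<in> R\<close> by (simp add: subring_add subring_mult subring_diff R(1))
      ultimately show ?case by blast
    qed
    then obtain s' where "s' \<in> R" "h ^ n = 1 - b * s'" by blast
    then have "inverse b = s + s'" using s \<open>b \<noteq> 0\<close> by (simp add: field_simps)
    then show False using R s \<open>s' \<in> R\<close> subring_add[OF R(1)] by simp
  qed
  have "w \<in> R \<or> inverse w \<in> R" for w
  proof (rule ccontr)
    assume w: "\<not> (w \<in> R \<or> inverse w \<in> R)"
    then have "w \<noteq> 0" using subring_zero[OF R(1)] by auto
    obtain r where r: "\<forall>i. coeff r i \<in> R" "b * poly r w = 1" using w adjoin_rel by blast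
    obtain s where s: "\<forall>i. coeff s i \<in> R" "b * poly s (inverse w) = 1" using w adjoin_rel by blast
    then show False
      using no_two_relations[OF R(1) \<open>b \<in> R\<close> R(3) units, of w "inverse w" r s] r s \<open>w \<noteq> 0\<close>
      by simp
  qed
  then show ?thesis using that[of R] R by (auto simp: is_valuation_ring_def)
qed

text \<open>For a valuation ring, this is its maximal ideal.  Note that \<open>inverse 0 = 0\<close>.\<close>

definition nonunits :: "'f::field set \<Rightarrow> 'f set" where
  "nonunits R = {f\<in>R. f = 0 \<or> inverse f \<notin> R}"

context
  fixes R :: "'f::field set"
  assumes R: "is_valuation_ring R"
begin

lemma valuation_ring_subring: "is_subring R"
  using R by (simp add: is_valuation_ring_def)

lemma valuation_ring_cases: "f \<in> R \<or> inverse f \<in> R"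
  using R by (simp add: is_valuation_ring_def)

lemma nonunits_mult:
  assumes "f \<in> nonunits R" "g \<in> R"
  shows "f * g \<in> nonunits R"
proof (cases "f * g = 0")
  case False
  then have *: "inverse f = g * inverse (f * g)" by (simp add: field_simps)
  have "inverse (f * g) \<notin> R"
  proof
    assume "inverse (f * g) \<in> R"
    then have "inverse f \<in> R"
      unfolding * by (rule subring_mult[OF valuation_ring_subring assms(2)])
    then show False using assms False by (auto simp: nonunits_def)
  qed
  moreover have "f * g \<in> R"
    using assms by (intro subring_mult[OF valuation_ring_subring]) (auto simp: nonunits_def)
  ultimately show ?thesis unfolding nonunits_def by blast
qed (use subring_zero[OF valuation_ring_subring] in \<open>auto simp: nonunits_def\<close>)

lemma nonunits_add:
  assumes "f \<in> nonunits R" "g \<in> nonunits R"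
  shows "f + g \<in> nonunits R"
proof -
  have *: "f + g \<in> nonunits R" if "f \<in> nonunits R" "f \<noteq> 0" "g / f \<in> R" for f g
  proof -
    have "f + g = f * (1 + g / f)" using that by (simp add: field_simps)
    then show ?thesis
      using nonunits_mult[of f "1 + g / f"] that valuation_ring_subring
      by (simp add: subring_add subring_one)
  qed
  consider "f = 0" | "g = 0" | "f \<noteq> 0" "g \<noteq> 0" by blast
  then show ?thesis
  proof cases
    case 3
    then have "g / f \<in> R \<or> f / g \<in> R" using valuation_ring_cases[of "g / f"] by simp
    then show ?thesis using * assms 3 by (metis add.commute)
  qed (use assms in auto)
qed

lemma nonunits_sum: "(\<And>i. i \<in> I \<Longrightarrow> f i \<in> nonunits R) \<Longrightarrow> (\<Sum>i\<in>I. f i) \<in> nonunits R"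
proof (induction I rule: infinite_finite_induct)
  case (insert i I)
  then show ?case by (simp add: nonunits_add)
qed (use subring_zero[OF valuation_ring_subring] in \<open>auto simp: nonunits_def\<close>)

lemma one_notin_nonunits: "1 \<notin> nonunits R"
  using subring_one[OF valuation_ring_subring] by (simp add: nonunits_def)

lemma valuation_ring_power_imp:
  assumes "f ^ n \<in> R" "0 < n"
  shows "f \<in> R"
proof (rule ccontr)
  assume f: "f \<notin> R"
  then have inv: "inverse f \<in> R" using valuation_ring_cases by blast
  have "f \<noteq> 0" using f subring_zero[OF valuation_ring_subring] by auto
  then have eq: "f ^ n * inverse f ^ (n - 1) = f"
    using \<open>0 < n\<close> by (cases n) (auto simp: power_inverse)
  have "f ^ n * inverse f ^ (n - 1) \<in> R"
    by (intro subring_mult subring_power valuation_ring_subring inv assms)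
  then show False using f eq by simp
qed

text \<open>
  After division by a dominant term, the other terms cannot all be nonunits, because their sum is
  \<open>- 1\<close>.
\<close>

lemma sum_zero_imp_associates:
  assumes "finite I" "(\<Sum>i\<in>I. f i) = 0" "i0 \<in> I" "f i0 \<noteq> 0"
  obtains i j where "i \<in> I" "j \<in> I" "i \<noteq> j" "f i \<noteq> 0" "f j \<noteq> 0" "f i / f j \<in> R" "f j / f i \<in> R"
proof -
  have dominant: "\<exists>i\<in>J. f i \<noteq> 0 \<and> (\<forall>j\<in>J. f j / f i \<in> R)"
    if "finite J" "\<exists>j\<in>J. f j \<noteq> 0" for J
    using that
  proof (induction J rule: finite_induct)
    case (insert k J)
    show ?case
    proof (cases "\<exists>j\<in>J. f j \<noteq> 0")
      case False
      then show ?thesis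
        using insert.prems subring_zero[OF valuation_ring_subring] subring_one[OF valuation_ring_subring]
        by auto
    next
      case True
      then obtain i where i: "i \<in> J" "f i \<noteq> 0" "\<forall>j\<in>J. f j / f i \<in> R" using insert by auto
      show ?thesis
      proof (cases "f k / f i \<in> R")
        case True
        then show ?thesis using i by auto
      next
        case False
        then have k: "f k \<noteq> 0" "f i / f k \<in> R"
          using subring_zero[OF valuation_ring_subring] valuation_ring_cases[of "f k / f i"] by auto
        have "f j / f k \<in> R" if "j \<in> J" for j
        proof -
          have "f j / f k = (f j / f i) * (f i / f k)" using i k by simp
          then show ?thesis using subring_mult[OF valuation_ring_subring] i k that by metis
        qed
        then show ?thesis using k subring_one[OF valuation_ring_subring] by auto
      qed
    qed
  qed auto
  obtain i where i: "i \<in> I" "f i \<noteq> 0" "\<And>j. j \<in> I \<Longrightarrow> f j / f i \<in> R"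
    using dominant[OF assms(1)] assms by blast
  have "\<exists>j\<in>I - {i}. f j / f i \<notin> nonunits R"
  proof (rule ccontr)
    assume "\<not> ?thesis"
    then have "(\<Sum>j\<in>I - {i}. f j / f i) \<in> nonunits R" by (intro nonunits_sum) blast
    moreover have "(\<Sum>j\<in>I - {i}. f j / f i) = - 1"
    proof -
      have "(\<Sum>j\<in>I. f j / f i) = 0" using assms by (simp flip: sum_divide_distrib)
      then show ?thesis using i assms(1) by (simp add: sum.remove eq_neg_iff_add_eq_0 add.commute)
    qed
    ultimately have "(- 1) * (- 1) \<in> nonunits R"
      by (intro nonunits_mult) (auto simp: subring_uminus subring_one valuation_ring_subring)
    then show False using one_notin_nonunits by simp
  qed
  then obtain j where j: "j \<in> I" "i \<noteq> j" "f j / f i \<notin> nonunits R" by auto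
  then show ?thesis
    using that[of i j] i unfolding nonunits_def by auto
qed

end

lemma (in place) is_valuation_ring_place: "is_valuation_ring {f. f = 0 \<or> 0 \<le> P f}"
  unfolding is_valuation_ring_def is_subring_def
proof (intro conjI ballI allI)
  fix f g assume fg: "f \<in> {f. f = 0 \<or> 0 \<le> P f}" "g \<in> {f. f = 0 \<or> 0 \<le> P f}"
  show "f - g \<in> {f. f = 0 \<or> 0 \<le> P f}"
    using fg value_add[of f "- g"] by fastforce
  show "f * g \<in> {f. f = 0 \<or> 0 \<le> P f}"
    using fg value_mult[of f g] by fastforce
next
  fix f show "f \<in> {f. f = 0 \<or> 0 \<le> P f} \<or> inverse f \<in> {f. f = 0 \<or> 0 \<le> P f}"
    using value_inverse[of f] by auto
qed auto

lemma (in place) nonunits_place: "nonunits {f. f = 0 \<or> 0 \<le> P f} = {f. f = 0 \<or> 0 < P f}"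
  using value_inverse by (auto simp: nonunits_def)

text \<open>The values form a subgroup of the integers; dividing by its generator normalizes them.\<close>

lemma place_of_valuation:
  fixes emb :: "'k::field \<Rightarrow> 'f::field" and V :: "'f \<Rightarrow> int"
  assumes mult: "\<And>f g. f \<noteq> 0 \<Longrightarrow> g \<noteq> 0 \<Longrightarrow> V (f * g) = V f + V g"
    and add: "\<And>f g. f \<noteq> 0 \<Longrightarrow> g \<noteq> 0 \<Longrightarrow> f + g \<noteq> 0 \<Longrightarrow> min (V f) (V g) \<le> V (f + g)"
    and const: "\<And>k. k \<noteq> 0 \<Longrightarrow> V (emb k) = 0"
    and "f0 \<noteq> 0" "V f0 \<noteq> 0"
  obtains P N where "point emb P" "0 < N" "\<And>f. f \<noteq> 0 \<Longrightarrow> V f = N * P f"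
proof -
  have one: "V 1 = 0" using mult[of 1 1] by simp
  have inv: "V (inverse f) = - V f" if "f \<noteq> 0" for f
    using mult[of f "inverse f"] that one by simp
  have pow: "V (f ^ i) = int i * V f" if "f \<noteq> 0" for f i
    using that by (induction i) (auto simp: one mult algebra_simps)
  have powi: "V (f powi k) = k * V f" if "f \<noteq> 0" for f k
    using that by (cases k rule: int_cases3) (auto simp: pow inv power_int_minus one)
  define n where "n = (LEAST n. 0 < n \<and> (\<exists>f. f \<noteq> 0 \<and> V f = int n))"
  have ex: "0 < nat \<bar>V f0\<bar> \<and> (\<exists>f. f \<noteq> 0 \<and> V f = int (nat \<bar>V f0\<bar>))"
    using assms(4,5) inv[of f0] by (cases "V f0 > 0") (auto intro: exI[of _ f0] exI[of _ "inverse f0"])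
  have n: "0 < n \<and> (\<exists>f. f \<noteq> 0 \<and> V f = int n)"
    unfolding n_def by (rule LeastI) (rule ex)
  then obtain u where u: "u \<noteq> 0" "V u = int n" by blast
  have dvd: "int n dvd V f" if "f \<noteq> 0" for f
  proof (rule ccontr)
    assume not_dvd: "\<not> int n dvd V f"
    define g where "g = f * u powi (- (V f div int n))"
    have "V g = V f - V f div int n * int n"
      using that u by (simp add: g_def mult powi)
    then have g: "g \<noteq> 0" "V g = V f mod int n"
      using that u by (auto simp: g_def minus_div_mult_eq_mod)
    moreover have "0 < V f mod int n" "V f mod int n < int n"
      using not_dvd n pos_mod_sign[of "int n" "V f"] pos_mod_bound[of "int n" "V f"]
      unfolding dvd_eq_mod_eq_0 by linarith+
    ultimately have "0 < nat (V g) \<and> (\<exists>f. f \<noteq> 0 \<and> V f = int (nat (V g)))"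
      by auto
    then have "n \<le> nat (V g)" unfolding n_def by (rule Least_le)
    then show False using g n \<open>V f mod int n < int n\<close> by linarith
  qed
  define P where "P f = (if f = 0 then 0 else V f div int n)" for f
  have V: "V f = int n * P f" if "f \<noteq> 0" for f
    using dvd[OF that] that by (simp add: P_def)
  have "point emb P"
    unfolding is_place_def
  proof (intro conjI ballI allI impI)
    fix k :: 'k assume "k \<noteq> 0"
    then show "P (emb k) = 0" using const by (simp add: P_def)
  next
    fix f g :: 'f assume "f \<in> UNIV - {0}" "g \<in> UNIV - {0}"
    then have "int n * P (f * g) = int n * (P f + P g)"
      using V[of f] V[of g] V[of "f * g"] mult[of f g] by (simp add: algebra_simps)
    then show "P (f * g) = P f + P g" using n by simp
  next
    fix f g :: 'f assume "f \<in> UNIV - {0}" "g \<in> UNIV - {0}" "f + g \<noteq> 0"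
    then have "min (int n * P f) (int n * P g) \<le> int n * P (f + g)"
      using V[of f] V[of g] V[of "f + g"] add[of f g] by simp
    then show "min (P f) (P g) \<le> P (f + g)" using n by (auto simp: min_def split: if_splits)
  next
    show "\<exists>f\<in>UNIV - {0}. P f = 1"
      using u n by (intro bexI[of _ u]) (auto simp: P_def)
  qed (auto simp: P_def)
  then show ?thesis using that[of P "int n"] n V by auto
qed

section \<open>The rational function field\<close>

lemma poly_factor_out:
  fixes \<pi> :: "'k::field poly"
  assumes "0 < degree \<pi>" "r \<noteq> 0"
  obtains k s where "r = \<pi> ^ k * s" "\<not> \<pi> dvd s"
proof -
  have "\<exists>k s. r = \<pi> ^ k * s \<and> \<not> \<pi> dvd s"
    using assms(2)
  proof (induction "degree r" arbitrary: r rule: less_induct)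
    case less
    show ?case
    proof (cases "\<pi> dvd r")
      case True
      then obtain s where s: "r = \<pi> * s" by auto
      then have "s \<noteq> 0" "\<pi> \<noteq> 0" using less.prems by auto
      then have "degree s < degree r" using s assms(1) by (simp add: degree_mult_eq)
      then obtain k s' where "s = \<pi> ^ k * s'" "\<not> \<pi> dvd s'" using less.hyps \<open>s \<noteq> 0\<close> by blast
      then show ?thesis using s by (intro exI[of _ "Suc k"] exI[of _ s']) auto
    qed (metis power_0 mult_1)
  qed
  then show ?thesis using that by blast
qed

locale ratfun_field = field_emb emb for emb :: "'k::field \<Rightarrow> 'f::field" +
  fixes x :: 'f
  assumes transcendental: "transcendental emb x"
begin

lemma ev_eq_0_iff [simp]: "ev x r = 0 \<longleftrightarrow> r = 0"
  using transcendental by (auto simp: transcendental_def ev_def)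

text \<open>
  The embedding of the rational function field \<open>K(x)\<close> into \<open>F\<close>.  Taking the fraction field as a type,
  rather than a subset of \<open>F\<close>, makes \<open>F\<close> a vector space over it.
\<close>

definition ratfun :: "'k poly fract \<Rightarrow> 'f" where
  "ratfun g = (SOME w. \<exists>r s. s \<noteq> 0 \<and> g = Fract r s \<and> w = ev x r / ev x s)"

lemma ratfun_Fract: "s \<noteq> 0 \<Longrightarrow> ratfun (Fract r s) = ev x r / ev x s"
  unfolding ratfun_def
proof (rule someI2, blast)
  fix w assume s: "s \<noteq> 0" and "\<exists>r' s'. s' \<noteq> 0 \<and> Fract r s = Fract r' s' \<and> w = ev x r' / ev x s'"
  then obtain r' s' where *: "s' \<noteq> 0" "Fract r s = Fract r' s'" "w = ev x r' / ev x s'" by blast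
  then have "r * s' = r' * s" using s eq_fract by metis
  then have "ev x r * ev x s' = ev x r' * ev x s" by (metis ev_mult)
  then show "w = ev x r / ev x s" using * s by (simp add: frac_eq_eq)
qed

lemma ratfun_poly: "ratfun (Fract r 1) = ev x r"
  by (simp add: ratfun_Fract)

lemma field_embedding_ratfun: "field_embedding ratfun"
  unfolding field_embedding_def
proof (intro conjI allI)
  show "ratfun 1 = 1" by (simp add: One_fract_def ratfun_poly)
next
  fix g h :: "'k poly fract"
  obtain r s r' s' where gh: "g = Fract r s" "s \<noteq> 0" "h = Fract r' s'" "s' \<noteq> 0"
    by (metis Fract_cases)
  show "ratfun (g + h) = ratfun g + ratfun h"
    using gh by (simp add: ratfun_Fract ev_add ev_mult add_frac_eq)
  show "ratfun (g * h) = ratfun g * ratfun h"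
    using gh by (simp add: ratfun_Fract ev_mult)
qed

sublocale K: field_emb ratfun
  by standard (rule field_embedding_ratfun)

lemma is_subfield_range_ratfun: "is_subfield (range ratfun)"
  unfolding is_subfield_def
  by (auto simp flip: K.emb_diff K.emb_mult K.emb_inverse) (metis K.emb_one rangeI)

lemma emb_in_range_ratfun: "emb k \<in> range ratfun" and x_in_range_ratfun: "x \<in> range ratfun"
  using ratfun_poly[of "[:k:]"] ratfun_poly[of "[:0, 1:]"] by (auto simp: image_iff) metis+

lemma is_subfield_adjoin: "is_subfield (adjoin emb S)"
  unfolding adjoin_def by (rule hull_in) (auto simp: is_subfield_def)

lemma adjoin_superset: "range emb \<union> S \<subseteq> adjoin emb S"
  unfolding adjoin_def by (rule hull_subset)

lemma adjoin_minimal: "is_subfield E \<Longrightarrow> range emb \<union> S \<subseteq> E \<Longrightarrow> adjoin emb S \<subseteq> E"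
  unfolding adjoin_def by (rule hull_minimal)

lemma adjoin_eq_range_ratfun: "adjoin emb {x} = range ratfun"
proof
  show "adjoin emb {x} \<subseteq> range ratfun"
    using emb_in_range_ratfun x_in_range_ratfun
    by (intro adjoin_minimal is_subfield_range_ratfun) auto
  show "range ratfun \<subseteq> adjoin emb {x}"
  proof
    fix f assume "f \<in> range ratfun"
    then obtain r s where "f = ev x r / ev x s"
      by (metis Fract_cases imageE ratfun_Fract)
    moreover have "ev x r \<in> adjoin emb {x}" for r
      using adjoin_superset[of "{x}"]
      by (intro ev_in_subring is_subfield_subring is_subfield_adjoin) auto
    ultimately show "f \<in> adjoin emb {x}"
      using is_subfield_adjoin[of "{x}"] by (auto simp: is_subfield_def divide_inverse)
  qed
qed

text \<open>
  Polynomials that are nonunits form an ideal, so division with remainder shows that one of least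
  degree generates it.
\<close>

lemma nonunits_polynomials:
  assumes R: "is_valuation_ring R" "range emb \<subseteq> R" "x \<in> R"
    and b: "b \<noteq> 0" "ev x b \<in> nonunits R"
  obtains \<pi> where "0 < degree \<pi>" "\<And>r. ev x r \<in> nonunits R \<longleftrightarrow> \<pi> dvd r"
proof -
  have ev_R: "ev x r \<in> R" for r
    using R by (intro ev_in_subring) (auto simp: is_valuation_ring_def)
  define n where "n = (LEAST n. \<exists>r. r \<noteq> 0 \<and> ev x r \<in> nonunits R \<and> degree r = n)"
  have "\<exists>\<pi>. \<pi> \<noteq> 0 \<and> ev x \<pi> \<in> nonunits R \<and> degree \<pi> = n"
    unfolding n_def by (rule LeastI_ex) (use b in blast)
  then obtain \<pi> where \<pi>: "\<pi> \<noteq> 0" "ev x \<pi> \<in> nonunits R" "degree \<pi> = n" by blast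
  have least: "n \<le> degree r" if "r \<noteq> 0" "ev x r \<in> nonunits R" for r
    unfolding n_def by (rule Least_le) (use that in blast)
  have "0 < degree \<pi>"
  proof (rule ccontr)
    assume "\<not> 0 < degree \<pi>"
    then obtain k where k: "\<pi> = [:k:]" by (metis degree_eq_zeroE neq0_conv)
    then have "inverse (ev x \<pi>) = emb (inverse k)" by (simp add: emb_inverse)
    then show False using \<pi> R k by (auto simp: nonunits_def)
  qed
  moreover have "ev x r \<in> nonunits R \<longleftrightarrow> \<pi> dvd r" for r
  proof
    assume "\<pi> dvd r"
    then show "ev x r \<in> nonunits R"
      using nonunits_mult[OF R(1) \<pi>(2)] ev_R by (auto simp: ev_mult)
  next
    assume r: "ev x r \<in> nonunits R"
    have "r mod \<pi> = r - \<pi> * (r div \<pi>)"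
      by (simp add: minus_mult_div_eq_mod)
    then have "ev x (r mod \<pi>) = ev x r + ev x \<pi> * ev x (- (r div \<pi>))"
      by (simp only: ev_uminus ev_diff ev_mult) simp
    then have "ev x (r mod \<pi>) \<in> nonunits R"
      using nonunits_add[OF R(1) r nonunits_mult[OF R(1) \<pi>(2) ev_R[of "- (r div \<pi>)"]]] by metis
    then have "r mod \<pi> = 0"
      using least[of "r mod \<pi>"] degree_mod_less[of \<pi> r] \<pi> by (metis linorder_not_less)
    then show "\<pi> dvd r" by auto
  qed
  ultimately show ?thesis using that by blast
qed

text \<open>
  A valuation ring of a finite extension of the rational function field in which some polynomial
  is not a unit is discrete: up to units, every polynomial is a power of one polynomial \<open>\<pi>\<close>, and
  the leading terms of an algebraic equation for \<open>w\<close> show that some power of \<open>w\<close> with exponent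
  at most \<open>m\<close> is, up to units, an integral power of \<open>\<pi>\<close>.  Hence \<open>w ^ m!\<close> is one as well, and its
  exponent is a valuation.
\<close>

theorem exists_place:
  assumes algebraic: "\<And>w. \<exists>c i. i \<le> m \<and> c i \<noteq> 0 \<and> (\<Sum>i\<le>m. ratfun (c i) * w ^ i) = 0"
    and b: "0 < degree b"
  obtains P where "point emb P" "0 \<le> P x" "0 < P (ev x b)"
proof -
  have "b \<noteq> 0" using b by auto
  have "inverse (ev x b) \<notin> range (ev x)"
  proof
    assume "inverse (ev x b) \<in> range (ev x)"
    then obtain r where "inverse (ev x b) = ev x r" by auto
    then have "ev x (r * b - 1) = 0" using \<open>b \<noteq> 0\<close> by (simp add: ev_diff ev_mult flip: \<open>_ = ev x r\<close>)
    then have "r * b = 1" by simp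
    then have "b dvd 1" by (metis dvd_triv_right)
    then show False using b \<open>b \<noteq> 0\<close> by (simp add: is_unit_iff_degree)
  qed
  moreover have "is_subring (range (ev x))"
    unfolding is_subring_def by (auto simp flip: ev_diff ev_mult) (metis ev_one rangeI)
  ultimately obtain R where R: "is_valuation_ring R" "range (ev x) \<subseteq> R" "inverse (ev x b) \<notin> R"
    using exists_valuation_ring[of "range (ev x)" "ev x b"] by auto
  note subring = valuation_ring_subring[OF R(1)]
  have emb_R: "range emb \<subseteq> R"
  proof clarify
    fix k
    show "emb k \<in> R" using subsetD[OF R(2) rangeI, of "[:k:]"] by simp
  qed
  have x_R: "x \<in> R"
    using subsetD[OF R(2) rangeI, of "[:0, 1:]"] by simp
  have "ev x b \<in> nonunits R"
    using R by (auto simp: nonunits_def)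
  then obtain \<pi> where \<pi>: "0 < degree \<pi>" "\<And>r. ev x r \<in> nonunits R \<longleftrightarrow> \<pi> dvd r"
    using nonunits_polynomials[OF R(1) emb_R x_R \<open>b \<noteq> 0\<close>] by blast
  define p where "p = ev x \<pi>"
  have p: "p \<noteq> 0" "p \<in> nonunits R" using \<pi> by (auto simp: p_def)
  then have "p \<in> R" by (simp add: nonunits_def)
  define U where "U = {f. f \<noteq> 0 \<and> f \<in> R \<and> inverse f \<in> R}"
  have U_mult: "f * g \<in> U" if "f \<in> U" "g \<in> U" for f g
    using that subring_mult[OF subring] by (auto simp: U_def)
  have U_inverse: "inverse f \<in> U" if "f \<in> U" for f
    using that by (auto simp: U_def)
  have U_divide: "f / g \<in> U" if "f \<in> U" "g \<in> U" for f g
    using U_mult[OF that(1) U_inverse[OF that(2)]] by (simp add: divide_inverse)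
  have U_one: "1 \<in> U" using subring_one[OF subring] by (simp add: U_def)
  have U_power: "f ^ i \<in> U" if "f \<in> U" for f i
    using that by (induction i) (auto simp: U_one U_mult)
  have U_nonunits: "f \<notin> U" if "f \<in> nonunits R" for f
    using that by (auto simp: U_def nonunits_def)
  have nonunit_power: "p powi k \<in> nonunits R" if k: "0 < k" for k
  proof -
    define j where "j = nat k - 1"
    have "nat k = Suc j" using k by (simp add: j_def)
    then have "p powi k = p * p ^ j" using k by (simp add: power_int_def)
    then show ?thesis
      using nonunits_mult[OF R(1) p(2)] subring_power[OF subring \<open>p \<in> R\<close>] by simp
  qed
  have power_in_U: "k = 0" if "p powi k \<in> U" for k
  proof (rule ccontr)
    assume "k \<noteq> 0"
    then have "0 < k \<or> 0 < - k" by auto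
    then show False
      using nonunit_power[of k] nonunit_power[of "- k"] U_nonunits that U_inverse[OF that]
      by (auto simp: power_int_minus)
  qed
  have poly_assoc: "\<exists>k. ev x r / p ^ k \<in> U" if r: "r \<noteq> 0" for r
  proof -
    obtain k s where s: "r = \<pi> ^ k * s" "\<not> \<pi> dvd s"
      using poly_factor_out[OF \<pi>(1) r] .
    then have "ev x s \<in> U"
      using \<pi>(2)[of s] R(2) that by (auto simp: U_def nonunits_def)
    then show ?thesis using s p by (intro exI[of _ k]) (simp add: ev_mult ev_power p_def)
  qed
  have ratfun_assoc: "\<exists>k. ratfun g / p powi k \<in> U" if "g \<noteq> 0" for g
  proof -
    obtain r s where g: "g = Fract r s" "s \<noteq> 0" by (metis Fract_cases)
    then have "r \<noteq> 0" using that by (auto simp: fract_collapse)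
    then obtain k l where "ev x r / p ^ k \<in> U" "ev x s / p ^ l \<in> U"
      using poly_assoc g by metis
    moreover have "ratfun g / p powi (int k - int l) = (ev x r / p ^ k) / (ev x s / p ^ l)"
      using g p by (simp add: ratfun_Fract power_int_diff)
    ultimately show ?thesis using U_divide by metis
  qed
  define L :: nat where "L = fact m"
  have "\<exists>e. w ^ L / p powi e \<in> U" if w: "w \<noteq> 0" for w
  proof -
    have "\<exists>k e. 0 < k \<and> k \<le> m \<and> w ^ k / p powi e \<in> U"
    proof -
      obtain c i0 where c: "i0 \<le> m" "c i0 \<noteq> 0" "(\<Sum>i\<le>m. ratfun (c i) * w ^ i) = 0"
        using algebraic[of w] by blast
      define h where "h i = ratfun (c i) * w ^ i" for i
      obtain i j where ij: "i \<in> {..m}" "j \<in> {..m}" "i \<noteq> j" "h i \<noteq> 0" "h j \<noteq> 0"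
        "h i / h j \<in> R" "h j / h i \<in> R"
        by (rule sum_zero_imp_associates[OF R(1), of "{..m}" h i0]) (use c w in \<open>auto simp: h_def\<close>)
      then have nz: "c i \<noteq> 0" "c j \<noteq> 0" by (auto simp: h_def)
      have h_U: "h i / h j \<in> U" "h j / h i \<in> U" using ij by (auto simp: U_def)
      have *: "\<exists>k e. 0 < k \<and> k \<le> m \<and> w ^ k / p powi e \<in> U"
        if hyps: "i < j" "j \<le> m" "c i \<noteq> 0" "c j \<noteq> 0"
          "ratfun (c j) * w ^ j / (ratfun (c i) * w ^ i) \<in> U" for i j
      proof -
        obtain e where e: "ratfun (c i / c j) / p powi e \<in> U"
          using ratfun_assoc[of "c i / c j"] hyps by auto
        have "w ^ j = w ^ (j - i) * w ^ i" using that by (simp flip: power_add)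
        then have "w ^ (j - i) / p powi e =
            (ratfun (c j) * w ^ j / (ratfun (c i) * w ^ i)) * (ratfun (c i / c j) / p powi e)"
          using that w p by (simp add: K.emb_divide)
        then have "w ^ (j - i) / p powi e \<in> U" using U_mult e that by metis
        then show ?thesis using that by (intro exI[of _ "j - i"]) auto
      qed
      show ?thesis
        using *[of i j] *[of j i] ij nz h_U unfolding h_def by (cases "i < j") auto
    qed
    then obtain k e where k: "0 < k" "k \<le> m" "w ^ k / p powi e \<in> U" by blast
    then have "k dvd L" by (simp add: L_def dvd_fact)
    then obtain l where l: "L = k * l" by auto
    have "w ^ L / p powi (e * int l) = (w ^ k / p powi e) ^ l"
      by (simp add: l power_mult power_divide power_int_mult)
    then show ?thesis using U_power[OF k(3)] by metis
  qed
  then obtain V where V: "\<And>w. w \<noteq> 0 \<Longrightarrow> w ^ L / p powi V w \<in> U" by metis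
  have V_eqI: "V w = e" if "w \<noteq> 0" "w ^ L / p powi e \<in> U" for w e
  proof -
    have "p powi (V w - e) = (w ^ L / p powi e) / (w ^ L / p powi V w)"
      using that p by (simp add: power_int_diff)
    then show ?thesis using power_in_U[of "V w - e"] U_divide[OF that(2) V[OF that(1)]] by simp
  qed
  have V_mult: "V (f * g) = V f + V g" if "f \<noteq> 0" "g \<noteq> 0" for f g
  proof (rule V_eqI)
    have "(f * g) ^ L / p powi (V f + V g) = (f ^ L / p powi V f) * (g ^ L / p powi V g)"
      using p by (simp add: power_int_add power_mult_distrib)
    then show "(f * g) ^ L / p powi (V f + V g) \<in> U" using U_mult V that by metis
  qed (use that in auto)
  have V_one: "V 1 = 0" by (rule V_eqI) (auto simp: U_one)
  have "0 < L" by (simp add: L_def)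
  have V_nonneg: "0 \<le> V f \<longleftrightarrow> f \<in> R" if "f \<noteq> 0" for f
  proof
    assume "0 \<le> V f"
    then have "p powi V f \<in> R"
      using subring_power[OF subring \<open>p \<in> R\<close>] by (simp add: power_int_def)
    moreover have "f ^ L / p powi V f \<in> R" using V[OF that] unfolding U_def by blast
    ultimately have "(f ^ L / p powi V f) * p powi V f \<in> R" by (intro subring_mult[OF subring])
    then have "f ^ L \<in> R" using p by simp
    then show "f \<in> R" using valuation_ring_power_imp[OF R(1) _ \<open>0 < L\<close>] by blast
  next
    assume f: "f \<in> R"
    show "0 \<le> V f"
    proof (rule ccontr)
      assume "\<not> 0 \<le> V f"
      then have "p powi (- V f) * f ^ L \<in> nonunits R"
        by (intro nonunits_mult R(1) nonunit_power subring_power subring f) auto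
      moreover have "p powi (- V f) * f ^ L = f ^ L / p powi V f"
        by (simp add: power_int_minus divide_inverse mult.commute)
      ultimately show False using V[OF that] U_nonunits by metis
    qed
  qed
  have V_add: "min (V f) (V g) \<le> V (f + g)" if "f \<noteq> 0" "g \<noteq> 0" "f + g \<noteq> 0" for f g
  proof -
    have *: "V f \<le> V (f + g)" if "f \<noteq> 0" "g \<noteq> 0" "f + g \<noteq> 0" "V f \<le> V g" for f g
    proof -
      have "V f + V (g / f) = V g" using V_mult[of f "g / f"] that by simp
      then have "g / f \<in> R" using V_nonneg[of "g / f"] that by simp
      then have R': "1 + g / f \<in> R" by (intro subring_add subring subring_one)
      have eq: "f + g = f * (1 + g / f)" using that by (simp add: field_simps)
      then have "1 + g / f \<noteq> 0" using that by auto
      then have "0 \<le> V (1 + g / f)" using V_nonneg R' by blast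
      then show ?thesis using V_mult[of f "1 + g / f"] that \<open>1 + g / f \<noteq> 0\<close> by (simp flip: eq)
    qed
    show ?thesis using *[of f g] *[of g f] that by (cases "V f \<le> V g") (auto simp: add.commute)
  qed
  have V_const: "V (emb k) = 0" if "k \<noteq> 0" for k
  proof -
    have "0 \<le> V (emb k)" "0 \<le> V (emb (inverse k))"
      using V_nonneg that emb_R by auto
    moreover have "V (emb k) + V (emb (inverse k)) = 0"
      using V_mult[of "emb k" "emb (inverse k)"] that V_one by (simp flip: emb_mult)
    ultimately show ?thesis by simp
  qed
  have "V p = int L" by (rule V_eqI) (auto simp: p U_one)
  then obtain P N where P: "point emb P" "0 < N" "\<And>f. f \<noteq> 0 \<Longrightarrow> V f = N * P f"
    using place_of_valuation[of V emb p] V_mult V_add V_const p \<open>0 < L\<close> by auto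
  have "x \<noteq> 0" using ev_eq_0_iff[of "[:0, 1:]"] by auto
  then have "0 \<le> P x" using V_nonneg x_R P by (auto simp: zero_le_mult_iff)
  have "V (ev x b) \<noteq> 0"
  proof
    assume "V (ev x b) = 0"
    then have "inverse (ev x b) ^ L \<in> R"
      using V[of "ev x b"] \<open>b \<noteq> 0\<close> by (auto simp: U_def power_inverse)
    then show False using valuation_ring_power_imp[OF R(1) _ \<open>0 < L\<close>] R(3) by blast
  qed
  moreover have "0 \<le> V (ev x b)" using V_nonneg R(2) \<open>b \<noteq> 0\<close> by auto
  ultimately have "0 < P (ev x b)"
    using P \<open>b \<noteq> 0\<close> by (auto simp: zero_le_mult_iff order_less_le)
  then show ?thesis using that P \<open>0 \<le> P x\<close> by blast
qed

section \<open>Values of rational functions\<close>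

context
  fixes P :: "'f \<Rightarrow> int"
  assumes P: "point emb P"
begin

interpretation place emb P by standard (rule P)

lemma value_ratfun_Fract:
  "r \<noteq> 0 \<Longrightarrow> s \<noteq> 0 \<Longrightarrow> P (ratfun (Fract r s)) = P (ev x r) - P (ev x s)"
  by (simp add: ratfun_Fract value_divide)

lemma range_emb_subset: "range emb \<subseteq> {f. f = 0 \<or> 0 \<le> P f}"
proof clarify
  fix k assume "\<not> 0 \<le> P (emb k)"
  then show "emb k = 0" by (cases "k = 0") auto
qed

lemma value_poly_nonneg:
  assumes "0 \<le> P x"
  shows "0 \<le> P (ev x r)"
proof -
  have "ev x r \<in> {f. f = 0 \<or> 0 \<le> P f}"
    using assms is_valuation_ring_place range_emb_subset
    by (intro ev_in_subring) (auto simp: is_valuation_ring_def)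
  then show ?thesis by (cases "r = 0") auto
qed

lemma value_poly_pole:
  assumes "P x < 0" "r \<noteq> 0"
  shows "P (ev x r) = int (degree r) * P x"
  using assms(2)
proof (induction r)
  case (pCons k r)
  show ?case
  proof (cases "r = 0")
    case True
    then show ?thesis using pCons by simp
  next
    case False
    have "x \<noteq> 0" using assms(1) by auto
    then have v: "P (x * ev x r) = (1 + int (degree r)) * P x"
      using False pCons.IH by (simp add: value_mult algebra_simps)
    then have "P (x * ev x r) < 0" using assms(1) by (simp add: mult_pos_neg)
    then have "P (x * ev x r + emb k) = P (x * ev x r)"
      using value_add_eq[of "x * ev x r" "emb k"] \<open>x \<noteq> 0\<close> False by (cases "k = 0") auto
    then show ?thesis using v False by (simp add: add.commute)
  qed
qed simp

lemma value_poly_zero: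
  assumes "0 < P (x - emb a)" "r \<noteq> 0"
  shows "P (ev x r) = int (order a r) * P (x - emb a)"
proof -
  have lin: "ev x [:- a, 1:] = x - emb a" by (simp add: emb_uminus)
  have xa: "x - emb a \<noteq> 0" using assms(1) by auto
  have "0 \<le> P x"
  proof -
    have "0 \<le> P (x - emb a + emb a)" if "x \<noteq> 0" "a \<noteq> 0"
      using value_add[of "x - emb a" "emb a"] assms(1) xa that by simp
    then show ?thesis using assms(1) by (cases "a = 0"; cases "x = 0") auto
  qed
  obtain s where s: "r = [:- a, 1:] ^ order a r * s" "\<not> [:- a, 1:] dvd s"
    using order_decomp[OF assms(2)] by blast
  then have "s \<noteq> 0" using assms(2) by auto
  have sa: "poly s a \<noteq> 0" using s(2) by (simp add: poly_eq_0_iff_dvd)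
  have "[:- a, 1:] dvd s - [:poly s a:]" by (simp flip: poly_eq_0_iff_dvd)
  then obtain s' where "s = [:poly s a:] + [:- a, 1:] * s'" by (metis add.commute diff_add_cancel dvdE)
  then have "ev x s = ev x ([:poly s a:] + [:- a, 1:] * s')" by (rule arg_cong)
  also have "\<dots> = emb (poly s a) + (x - emb a) * ev x s'" unfolding ev_add ev_mult lin by simp
  finally have "ev x s = emb (poly s a) + (x - emb a) * ev x s'" .
  moreover have "(x - emb a) * ev x s' = 0 \<or> 0 < P ((x - emb a) * ev x s')"
    using value_poly_nonneg[OF \<open>0 \<le> P x\<close>, of s'] assms(1) xa
    by (cases "s' = 0") (auto simp: value_mult)
  ultimately have "P (ev x s) = 0"
    using value_add_eq[of "emb (poly s a)" "(x - emb a) * ev x s'"] sa by auto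
  moreover have "ev x r = (x - emb a) ^ order a r * ev x s"
    using arg_cong[OF s(1), of "ev x"] unfolding ev_mult ev_power lin .
  ultimately show ?thesis using xa \<open>s \<noteq> 0\<close> by (simp add: value_mult value_power)
qed

text \<open>Here \<open>\<pi>\<close> is the irreducible polynomial that defines the place of \<open>K(x)\<close> below \<open>P\<close>.\<close>

lemma local_parameter:
  assumes "0 \<le> P x" "b \<noteq> 0" "0 < P (ev x b)"
  obtains \<pi> where "0 < degree \<pi>" "\<And>r. r \<noteq> 0 \<Longrightarrow> 0 < P (ev x r) \<longleftrightarrow> \<pi> dvd r"
proof -
  obtain \<pi> where "0 < degree \<pi>" "\<And>r. ev x r \<in> {f. f = 0 \<or> 0 < P f} \<longleftrightarrow> \<pi> dvd r"
    using nonunits_polynomials[OF is_valuation_ring_place range_emb_subset, of b] assms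
    unfolding nonunits_place by auto
  then show ?thesis using that[of \<pi>] by auto
qed

text \<open>
  A polynomial with derivative \<open>1\<close> has only simple zeros, so at each of them it is a local parameter
  of the rational function field.  Hence its value is the ramification index, and this divides all
  values of rational functions.
\<close>

lemma value_separable_dvd:
  assumes "0 \<le> P x" "pderiv T = 1" "0 < P (ev x T)" "g \<noteq> 0"
  shows "P (ev x T) dvd P (ratfun g)"
proof -
  have "T \<noteq> 0" using assms(2) by auto
  then obtain \<pi> where \<pi>: "0 < degree \<pi>" "\<And>r. r \<noteq> 0 \<Longrightarrow> 0 < P (ev x r) \<longleftrightarrow> \<pi> dvd r"
    using local_parameter assms by blast
  have unit: "P (ev x s) = 0" if "\<not> \<pi> dvd s" for s
  proof -
    have "s \<noteq> 0" using that by auto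
    then show ?thesis using \<pi>(2)[of s] that value_poly_nonneg[OF assms(1), of s] by simp
  qed
  have "\<pi> \<noteq> 0" using \<pi> by auto
  have mult: "P (ev x \<pi>) dvd P (ev x r)" if r: "r \<noteq> 0" for r
  proof -
    obtain k s where s: "r = \<pi> ^ k * s" "\<not> \<pi> dvd s" using poly_factor_out[OF \<pi>(1) r] .
    then show ?thesis
      using \<open>\<pi> \<noteq> 0\<close> that unit by (auto simp: ev_mult ev_power value_mult value_power)
  qed
  obtain s where s: "T = \<pi> * s" using \<pi>(2)[OF \<open>T \<noteq> 0\<close>] assms(3) by auto
  have "\<not> \<pi> dvd s"
  proof
    assume "\<pi> dvd s"
    then have "\<pi> dvd pderiv T" unfolding s pderiv_mult by (intro dvd_add) auto
    then show False using \<pi> \<open>\<pi> \<noteq> 0\<close> assms(2) by (simp add: is_unit_iff_degree)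
  qed
  then have "P (ev x T) = P (ev x \<pi>)"
    using unit \<open>T \<noteq> 0\<close> s by (auto simp: ev_mult value_mult)
  moreover obtain r s where "g = Fract r s" "s \<noteq> 0" by (metis Fract_cases)
  moreover from this have "r \<noteq> 0" using assms(4) by (auto simp: fract_collapse)
  ultimately show ?thesis using mult value_ratfun_Fract by (auto intro: dvd_diff)
qed

lemma value_ratfun_pole:
  assumes "P x < 0" "g \<noteq> 0"
  obtains k where "P (ratfun g) = k * P x"
proof -
  obtain r s where g: "g = Fract r s" "s \<noteq> 0" by (metis Fract_cases)
  then have "r \<noteq> 0" using assms(2) by (auto simp: fract_collapse)
  then have "P (ratfun g) = (int (degree r) - int (degree s)) * P x"
    using g assms(1) by (simp add: value_ratfun_Fract value_poly_pole algebra_simps)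
  then show ?thesis using that by blast
qed

end

text \<open>
  There is a place at which a nonconstant denominator vanishes; if the denominator has least degree,
  then the numerator does not vanish there, and the quotient has a pole.
\<close>

lemma ratfun_poly_of_nonneg:
  assumes algebraic: "\<And>w. \<exists>c i. i \<le> m \<and> c i \<noteq> 0 \<and> (\<Sum>i\<le>m. ratfun (c i) * w ^ i) = 0"
    and nonneg: "\<And>P. point emb P \<Longrightarrow> 0 \<le> P x \<Longrightarrow> 0 \<le> P (ratfun g)"
  obtains r where "ratfun g = ev x r"
proof (cases "g = 0")
  case True
  then show ?thesis using that[of 0] by simp
next
  case False
  define n where "n = (LEAST n. \<exists>r s. s \<noteq> 0 \<and> g = Fract r s \<and> degree s = n)"
  have "\<exists>r s. s \<noteq> 0 \<and> g = Fract r s \<and> degree s = n"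
    unfolding n_def by (rule LeastI_ex) (metis Fract_cases)
  then obtain r s where rs: "s \<noteq> 0" "g = Fract r s" "degree s = n" by blast
  have least: "n \<le> degree s'" if "s' \<noteq> 0" "g = Fract r' s'" for r' s'
    unfolding n_def by (rule Least_le) (use that in blast)
  have "r \<noteq> 0" using False rs by (auto simp: fract_collapse)
  have "degree s = 0"
  proof (rule ccontr)
    assume "degree s \<noteq> 0"
    then obtain P where P: "point emb P" "0 \<le> P x" "0 < P (ev x s)"
      using exists_place[OF algebraic, of s] by auto
    obtain \<pi> where \<pi>: "0 < degree \<pi>" "\<And>r. r \<noteq> 0 \<Longrightarrow> 0 < P (ev x r) \<longleftrightarrow> \<pi> dvd r"
      using local_parameter[OF P(1,2) rs(1) P(3)] by blast
    obtain s' where s': "s = \<pi> * s'" using \<pi> P rs by auto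
    have "\<not> \<pi> dvd r"
    proof
      assume "\<pi> dvd r"
      then obtain r' where "r = \<pi> * r'" by auto
      then have "g = Fract r' s'" using rs s' by (auto simp: mult_fract_cancel)
      moreover have "s' \<noteq> 0" "degree s' < n" using rs s' \<pi> by (auto simp: degree_mult_eq)
      ultimately show False using least by force
    qed
    then have "P (ev x r) = 0" using \<pi>(2)[OF \<open>r \<noteq> 0\<close>] value_poly_nonneg[OF P(1,2), of r] by simp
    then have "P (ratfun g) < 0" using rs \<open>r \<noteq> 0\<close> P by (simp add: value_ratfun_Fract)
    then show False using nonneg[OF P(1,2)] by simp
  qed
  then obtain k where "s = [:k:]" by (metis degree_eq_zeroE)
  then have "ratfun g = ev x (smult (inverse k) r)"
    using rs by (simp add: ratfun_Fract ev_smult emb_inverse divide_inverse mult.commute)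
  then show ?thesis using that by blast
qed

text \<open>
  The exchange lemma for families instead of sets: a repetition counts as a relation.
\<close>

lemma linear_relation:
  fixes w v :: "nat \<Rightarrow> 'f"
  assumes "\<And>i. i \<le> m \<Longrightarrow> \<exists>c. w i = (\<Sum>j<m. ratfun (c j) * v j)"
  obtains c i where "i \<le> m" "c i \<noteq> 0" "(\<Sum>i\<le>m. ratfun (c i) * w i) = 0"
proof -
  interpret V: vector_space "\<lambda>g f. ratfun g * f"
    by standard (auto simp: K.emb_add K.emb_mult algebra_simps)
  show ?thesis
  proof (cases "inj_on w {..m}")
    case False
    then obtain i j where ij: "i \<le> m" "j \<le> m" "i \<noteq> j" "w i = w j" by (auto simp: inj_on_def)
    define c :: "nat \<Rightarrow> 'k poly fract" where "c k = (if k = i then 1 else if k = j then - 1 else 0)" for k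
    have "(\<Sum>k\<le>m. ratfun (c k) * w k) = (\<Sum>k\<in>{i, j}. ratfun (c k) * w k)"
      by (rule sum.mono_neutral_right) (use ij in \<open>auto simp: c_def\<close>)
    also have "\<dots> = 0" using ij by (simp add: c_def K.emb_uminus)
    finally show ?thesis using that[of i c] ij by (simp add: c_def)
  next
    case True
    have "w ` {..m} \<subseteq> V.span (v ` {..<m})"
    proof
      fix f assume "f \<in> w ` {..m}"
      then obtain c where "f = (\<Sum>j<m. ratfun (c j) * v j)" using assms by auto
      moreover have "v j \<in> V.span (v ` {..<m})" if "j < m" for j
        using that by (intro V.span_base) auto
      ultimately show "f \<in> V.span (v ` {..<m})"
        by (auto intro!: V.span_sum V.span_scale)
    qed
    moreover have "card (v ` {..<m}) < card (w ` {..m})"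
      using card_image_le[of "{..<m}" v] by (simp add: card_image[OF True])
    ultimately have "V.dependent (w ` {..m})"
      using V.independent_span_bound[of "v ` {..<m}" "w ` {..m}"] by auto
    then obtain u i where u: "i \<le> m" "u (w i) \<noteq> 0" "(\<Sum>f\<in>w ` {..m}. ratfun (u f) * f) = 0"
      by (auto simp: V.dependent_finite)
    then show ?thesis
      using that[of i "u \<circ> w"] by (simp add: sum.reindex[OF True] o_def)
  qed
qed

end

section \<open>Kummer extensions of the rational function field\<close>

text \<open>
  The pole \<open>P_inf\<close> of \<open>x\<close> serves to show that \<open>z\<close> has degree \<open>m\<close> over the rational function field.
\<close>

locale kummer_extension = ratfun_field emb x
  for emb :: "'k::field \<Rightarrow> 'f::field" and x :: 'f +
  fixes z :: 'f and m :: nat and H :: "'k poly" and P_inf :: "'f \<Rightarrow> int"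
  assumes m_pos: "0 < m" and H_nz: "H \<noteq> 0"
    and z_pow: "z ^ m = ev x H"
    and generated: "adjoin emb {x, z} = UNIV"
    and P_inf: "point emb P_inf" "P_inf x < 0"
    and coprime_degree: "coprime (degree H) m"
    and card_roots_unity: "card {\<zeta>::'k. \<zeta> ^ m = 1} = m"
    and char_not_dvd: "of_nat m \<noteq> (0::'k)"
begin

interpretation P_inf: place emb P_inf by standard (rule P_inf)

lemma z_nz: "z \<noteq> 0"
  using z_pow H_nz m_pos by (auto simp: zero_power)

lemma value_z:
  assumes "point emb P"
  shows "int m * P z = P (ev x H)"
proof -
  interpret place emb P by standard (rule assms)
  show ?thesis using value_power[OF z_nz, of m] by (simp add: z_pow)
qed

text \<open>
  The value of \<open>z\<close> at infinity is \<open>degree H / m\<close> times the value of \<open>x\<close>, and the values of \<open>g\<close> and \<open>h\<close>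
  are integral multiples of the latter.
\<close>

lemma distinct_values_infinity:
  assumes "i < m" "j < m" "i \<noteq> j" "g \<noteq> 0" "h \<noteq> 0"
  shows "P_inf (ratfun g * z ^ i) \<noteq> P_inf (ratfun h * z ^ j)"
proof
  assume eq: "P_inf (ratfun g * z ^ i) = P_inf (ratfun h * z ^ j)"
  obtain k where k: "P_inf (ratfun g) = k * P_inf x"
    using value_ratfun_pole[OF P_inf \<open>g \<noteq> 0\<close>] .
  obtain l where l: "P_inf (ratfun h) = l * P_inf x"
    using value_ratfun_pole[OF P_inf \<open>h \<noteq> 0\<close>] .
  have z: "int m * P_inf z = int (degree H) * P_inf x"
    using value_z[OF P_inf(1)] value_poly_pole[OF P_inf H_nz] by simp
  have "k * P_inf x + int i * P_inf z = l * P_inf x + int j * P_inf z"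
    using eq k l assms z_nz by (simp add: P_inf.value_mult P_inf.value_power)
  then have "int m * (k * P_inf x + int i * P_inf z) = int m * (l * P_inf x + int j * P_inf z)"
    by simp
  then have "P_inf x * (int m * k + int i * int (degree H)) = P_inf x * (int m * l + int j * int (degree H))"
    using z by (simp add: algebra_simps)
  then have "int m * k + int i * int (degree H) = int m * l + int j * int (degree H)"
    using P_inf(2) by simp
  then have "(int i - int j) * int (degree H) = int m * (l - k)"
    by (simp add: algebra_simps)
  then have "int m dvd (int i - int j) * int (degree H)" by simp
  then have "int m dvd int i - int j"
    using coprime_degree by (simp add: coprime_dvd_mult_left_iff coprime_commute)
  moreover have "\<bar>int i - int j\<bar> < int m" "int i - int j \<noteq> 0" using assms(1-3) by auto
  ultimately show False using dvd_imp_le_int[of "int i - int j" "int m"] by simp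
qed

lemma independent_of_distinct_values:
  assumes "point emb P" "\<And>i. i < m \<Longrightarrow> w i \<noteq> 0"
    and distinct: "\<And>i j g h. i < m \<Longrightarrow> j < m \<Longrightarrow> i \<noteq> j \<Longrightarrow> g \<noteq> 0 \<Longrightarrow> h \<noteq> 0 \<Longrightarrow>
      P (ratfun g * w i) \<noteq> P (ratfun h * w j)"
    and zero: "(\<Sum>i<m. ratfun (c i) * w i) = 0" and "i < m"
  shows "c i = 0"
proof (rule ccontr)
  assume "c i \<noteq> 0"
  interpret place emb P by standard (rule assms)
  show False
    by (rule value_sum_distinct[of "{..<m}" i "\<lambda>i. ratfun (c i) * w i"])
      (use assms \<open>c i \<noteq> 0\<close> in auto)
qed

lemma monomials_independent:
  assumes "(\<Sum>i<m. ratfun (c i) * z ^ i) = 0" "i < m"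
  shows "c i = 0"
  using assms z_nz distinct_values_infinity
  by (intro independent_of_distinct_values[OF P_inf(1), of "\<lambda>i. z ^ i" c]) auto

definition z_equation :: "'k poly fract poly" where
  "z_equation = monom 1 m - [:Fract H 1:]"

lemma ev_z_equation: "w ^ m = ev x H \<Longrightarrow> K.ev w z_equation = 0"
  by (simp add: z_equation_def K.ev_diff K.ev_monom ratfun_poly)

lemma degree_z_equation: "degree z_equation = m"
proof -
  have "z_equation = monom 1 m + [:- Fract H 1:]" by (simp add: z_equation_def)
  then show ?thesis
    using m_pos degree_add_eq_left[of "[:- Fract H 1:]" "monom 1 m"] by (simp add: degree_monom_eq)
qed

lemma z_equation_reduce: "w ^ m = ev x H \<Longrightarrow> K.ev w r = (\<Sum>i<m. ratfun (coeff (r mod z_equation) i) * w ^ i)"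
proof -
  assume w: "w ^ m = ev x H"
  have "z_equation \<noteq> 0" using degree_z_equation m_pos by auto
  then have deg: "degree (r mod z_equation) < m"
    using degree_mod_less[of z_equation r] degree_z_equation m_pos by auto
  have "K.ev w r = K.ev w (z_equation * (r div z_equation) + r mod z_equation)" by simp
  also have "\<dots> = K.ev w (r mod z_equation)"
    using ev_z_equation[OF w] by (simp only: K.ev_add K.ev_mult) simp
  finally show ?thesis using K.ev_altdef[OF deg] by simp
qed

text \<open>
  The polynomials in \<open>z\<close> over the rational function field are closed under inverses: in a relation between
  \<open>1\<close> and the \<open>m\<close> products of \<open>w\<close> with the powers of \<open>z\<close>, the coefficient of \<open>1\<close> cannot vanish.
\<close>

lemma range_ev_z: "range (K.ev z) = UNIV"
proof -
  have "is_subfield (range (K.ev z))"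
    unfolding is_subfield_def
  proof (intro conjI ballI)
    show "1 \<in> range (K.ev z)" by (metis K.ev_one rangeI)
  next
    fix f g assume "f \<in> range (K.ev z)" "g \<in> range (K.ev z)"
    then show "f - g \<in> range (K.ev z)" "f * g \<in> range (K.ev z)"
      by (auto simp flip: K.ev_diff K.ev_mult)
  next
    fix f assume "f \<in> range (K.ev z)"
    then obtain r where f: "f = K.ev z r" by auto
    show "inverse f \<in> range (K.ev z)"
    proof (cases "f = 0")
      case True
      then show ?thesis by (metis K.ev_zero inverse_zero rangeI)
    next
      case False
      define w where "w i = (if i < m then f * z ^ i else 1)" for i
      have "\<exists>c. w i = (\<Sum>j<m. ratfun (c j) * z ^ j)" for i
      proof -
        have "w i = K.ev z (if i < m then r * monom 1 i else 1)"
          by (simp add: w_def f K.ev_mult K.ev_monom)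
        then show ?thesis unfolding z_equation_reduce[OF z_pow] by blast
      qed
      then obtain c i0 where c: "i0 \<le> m" "c i0 \<noteq> 0" "(\<Sum>i\<le>m. ratfun (c i) * w i) = 0"
        using linear_relation[of m w "\<lambda>j. z ^ j"] by metis
      define s where "s = (\<Sum>i<m. monom (c i) i)"
      have s: "K.ev z s = (\<Sum>i<m. ratfun (c i) * z ^ i)"
        by (simp add: s_def K.ev_sum K.ev_monom)
      have "(\<Sum>i\<le>m. ratfun (c i) * w i) = (\<Sum>i<m. ratfun (c i) * w i) + ratfun (c m)"
        by (simp add: w_def flip: lessThan_Suc_atMost)
      also have "(\<Sum>i<m. ratfun (c i) * w i) = f * K.ev z s"
        by (simp add: s w_def sum_distrib_left mult_ac)
      finally have rel: "f * K.ev z s = - ratfun (c m)" using c by (simp add: eq_neg_iff_add_eq_0)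
      have "c m \<noteq> 0"
      proof
        assume "c m = 0"
        then have "(\<Sum>i<m. ratfun (c i) * z ^ i) = 0" using rel False s by simp
        then have "c i = 0" if "i < m" for i using monomials_independent that by blast
        then show False using c \<open>c m = 0\<close> by (metis order_le_less)
      qed
      then have "inverse f = - inverse (ratfun (c m)) * K.ev z s"
        using rel False by (simp add: field_simps)
      also have "\<dots> = K.ev z (smult (- inverse (c m)) s)"
        by (simp only: K.ev_smult K.emb_uminus K.emb_inverse)
      finally have "inverse f = K.ev z (smult (- inverse (c m)) s)" .
      then show ?thesis by blast
    qed
  qed
  moreover have "range emb \<union> {x, z} \<subseteq> range (K.ev z)"
  proof -
    have "f \<in> range (K.ev z)" if f: "f \<in> range ratfun" for f
    proof -
      obtain g where "f = ratfun g" using f by blast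
      then show ?thesis by (intro range_eqI[of _ _ "[:g:]"]) simp
    qed
    moreover have "z \<in> range (K.ev z)" by (intro range_eqI[of _ _ "[:0, 1:]"]) simp
    ultimately show ?thesis using emb_in_range_ratfun x_in_range_ratfun by blast
  qed
  ultimately have "adjoin emb {x, z} \<subseteq> range (K.ev z)" by (rule adjoin_minimal)
  then show ?thesis using generated by auto
qed

lemma monomials_span: obtains c where "f = (\<Sum>i<m. ratfun (c i) * z ^ i)"
proof -
  obtain r where "f = K.ev z r" using range_ev_z by blast
  then show ?thesis using that z_equation_reduce[OF z_pow] by blast
qed

lemma relation:
  obtains c i where "i \<le> m" "c i \<noteq> 0" "(\<Sum>i\<le>m. ratfun (c i) * w i) = 0"
proof (rule linear_relation[of m w "\<lambda>j. z ^ j"])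
  fix i show "\<exists>c. w i = (\<Sum>j<m. ratfun (c j) * z ^ j)" using monomials_span by metis
qed (rule that)

lemma algebraic: "\<exists>c i. i \<le> m \<and> c i \<noteq> 0 \<and> (\<Sum>i\<le>m. ratfun (c i) * w ^ i) = 0"
  by (rule relation[of "\<lambda>i. w ^ i"]) blast

text \<open>The extension has degree \<open>m\<close>, so \<open>m\<close> independent elements form a basis.\<close>

lemma independent_imp_span:
  assumes "\<And>c i. (\<Sum>i<m. ratfun (c i) * w i) = 0 \<Longrightarrow> i < m \<Longrightarrow> c i = 0"
  obtains c where "f = (\<Sum>i<m. ratfun (c i) * w i)"
proof -
  define v where "v i = (if i < m then w i else f)" for i
  obtain c i0 where c: "i0 \<le> m" "c i0 \<noteq> 0" "(\<Sum>i\<le>m. ratfun (c i) * v i) = 0"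
    using relation by blast
  have "(\<Sum>i\<le>m. ratfun (c i) * v i) = (\<Sum>i<m. ratfun (c i) * v i) + ratfun (c m) * f"
    by (simp add: v_def flip: lessThan_Suc_atMost)
  also have "(\<Sum>i<m. ratfun (c i) * v i) = (\<Sum>i<m. ratfun (c i) * w i)"
    by (simp add: v_def)
  finally have rel: "(\<Sum>i<m. ratfun (c i) * w i) + ratfun (c m) * f = 0" using c by simp
  have "c m \<noteq> 0"
  proof
    assume "c m = 0"
    then have "c i = 0" if "i < m" for i using rel assms[of c] that by simp
    then show False using c \<open>c m = 0\<close> by (metis order_le_less)
  qed
  then have "f = - (\<Sum>i<m. ratfun (c i) * w i) / ratfun (c m)"
    using rel by (simp add: field_simps eq_neg_iff_add_eq_0 add.commute)
  also have "\<dots> = (\<Sum>i<m. ratfun (- c i / c m) * w i)"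
    by (simp add: K.emb_divide K.emb_uminus sum_divide_distrib sum_negf)
  finally show ?thesis using that[of "\<lambda>i. - c i / c m"] by simp
qed

section \<open>The Galois action\<close>

text \<open>
  The automorphism over the rational function field that multiplies \<open>z\<close> by an \<open>m\<close>-th root of unity.
\<close>

definition twist :: "'k \<Rightarrow> 'f \<Rightarrow> 'f" where
  "twist \<zeta> f = K.ev (emb \<zeta> * z) (SOME r. K.ev z r = f)"

context
  fixes \<zeta> :: 'k
  assumes \<zeta>: "\<zeta> ^ m = 1"
begin

lemma twist_z_pow: "(emb \<zeta> * z) ^ m = ev x H"
  by (simp add: power_mult_distrib z_pow \<zeta> flip: emb_power)

text \<open>
  The choice of the polynomial does not matter: \<open>z\<close> and its multiple satisfy the same equation of
  degree \<open>m\<close>, and \<open>z\<close> satisfies no equation of smaller degree.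
\<close>

lemma twist_ev: "twist \<zeta> (K.ev z r) = K.ev (emb \<zeta> * z) r"
  unfolding twist_def
proof (rule someI2)
  show "K.ev z r = K.ev z r" ..
next
  fix s assume "K.ev z s = K.ev z r"
  then have "K.ev z (s - r) = 0" by (simp add: K.ev_diff)
  then have "coeff ((s - r) mod z_equation) i = 0" if "i < m" for i
    using that monomials_independent unfolding z_equation_reduce[OF z_pow] by blast
  then have "K.ev (emb \<zeta> * z) (s - r) = 0"
    unfolding z_equation_reduce[OF twist_z_pow] by simp
  then show "K.ev (emb \<zeta> * z) s = K.ev (emb \<zeta> * z) r" by (simp add: K.ev_diff)
qed

lemma twist_sum:
  "twist \<zeta> (\<Sum>i<m. ratfun (c i) * z ^ i) = (\<Sum>i<m. emb \<zeta> ^ i * (ratfun (c i) * z ^ i))"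
  using twist_ev[of "\<Sum>i<m. monom (c i) i"]
  by (simp add: K.ev_sum K.ev_monom power_mult_distrib mult_ac)

lemma twist_ratfun: "twist \<zeta> (ratfun g) = ratfun g"
  using twist_ev[of "[:g:]"] by simp

lemma twist_z: "twist \<zeta> z = emb \<zeta> * z"
  using twist_ev[of "[:0, 1:]"] by simp

lemma twist_add: "twist \<zeta> (f + g) = twist \<zeta> f + twist \<zeta> g"
proof -
  obtain r s where "f = K.ev z r" "g = K.ev z s" using range_ev_z by blast
  then show ?thesis by (simp add: twist_ev flip: K.ev_add)
qed

lemma twist_mult: "twist \<zeta> (f * g) = twist \<zeta> f * twist \<zeta> g"
proof -
  obtain r s where "f = K.ev z r" "g = K.ev z s" using range_ev_z by blast
  then show ?thesis by (simp add: twist_ev flip: K.ev_mult)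
qed

lemma twist_emb: "twist \<zeta> (emb k) = emb k"
  using emb_in_range_ratfun twist_ratfun by (metis imageE)

lemma twist_diff: "twist \<zeta> (f - g) = twist \<zeta> f - twist \<zeta> g"
  using twist_add[of "f - g" g] by (simp add: algebra_simps)

lemma twist_zero: "twist \<zeta> 0 = 0"
  using twist_diff[of 0 0] by simp

lemma twist_power: "twist \<zeta> (f ^ i) = twist \<zeta> f ^ i"
  using twist_emb[of 1] by (induction i) (auto simp: twist_mult)

lemma twist_eq_0_iff: "twist \<zeta> f = 0 \<longleftrightarrow> f = 0"
proof
  assume "twist \<zeta> f = 0"
  then have "twist \<zeta> (f * inverse f) = 0" by (simp add: twist_mult)
  then show "f = 0" using twist_emb[of 1] by (cases "f = 0") auto
qed (simp add: twist_zero)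

end

lemma twist_inverse:
  assumes "\<zeta> ^ m = 1"
  shows "twist \<zeta> (twist (inverse \<zeta>) f) = f"
proof -
  have inv: "inverse \<zeta> ^ m = 1" using assms by (simp add: power_inverse)
  have nz: "emb \<zeta> \<noteq> 0" using assms m_pos by (auto simp: zero_power)
  obtain c where c: "f = (\<Sum>i<m. ratfun (c i) * z ^ i)" by (rule monomials_span)
  define d where "d i = Fract [:inverse \<zeta> ^ i:] 1 * c i" for i
  have d: "ratfun (d i) = inverse (emb \<zeta>) ^ i * ratfun (c i)" for i
    by (simp add: d_def K.emb_mult ratfun_poly emb_power emb_inverse)
  have "twist (inverse \<zeta>) f = (\<Sum>i<m. ratfun (d i) * z ^ i)"
    unfolding c twist_sum[OF inv] d by (simp add: emb_inverse mult_ac)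
  then have "twist \<zeta> (twist (inverse \<zeta>) f) = (\<Sum>i<m. emb \<zeta> ^ i * (ratfun (d i) * z ^ i))"
    by (simp add: twist_sum[OF assms])
  also have "\<dots> = f"
    unfolding c d using nz by (intro sum.cong refl) (simp add: power_inverse)
  finally show ?thesis .
qed

lemma point_twist:
  assumes "point emb P" "\<zeta> ^ m = 1"
  shows "point emb (\<lambda>f. P (twist \<zeta> f))"
proof -
  interpret place emb P by standard (rule assms)
  obtain u where u: "u \<noteq> 0" "P u = 1" using uniformizer by blast
  have inv: "inverse \<zeta> ^ m = 1" using assms by (simp add: power_inverse)
  show ?thesis
    unfolding is_place_def
  proof (intro conjI ballI allI impI)
    show "\<exists>f\<in>UNIV - {0}. P (twist \<zeta> f) = 1"
      using u twist_inverse[OF assms(2)] twist_eq_0_iff[OF inv]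
      by (intro bexI[of _ "twist (inverse \<zeta>) u"]) auto
  next
    fix f g :: 'f assume "f \<in> UNIV - {0}" "g \<in> UNIV - {0}" "f + g \<noteq> 0"
    then show "min (P (twist \<zeta> f)) (P (twist \<zeta> g)) \<le> P (twist \<zeta> (f + g))"
      using value_add[of "twist \<zeta> f" "twist \<zeta> g"] twist_eq_0_iff[OF assms(2)]
      by (simp flip: twist_add[OF assms(2)])
  qed (auto simp: twist_zero twist_emb twist_mult twist_eq_0_iff assms(2) value_mult)
qed

text \<open>
  If \<open>m\<close> does not divide \<open>k\<close>, then some \<open>m\<close>-th root of unity \<open>\<xi>\<close> has \<open>\<xi> ^ k \<noteq> 1\<close>, since \<open>X ^ (k mod m) - 1\<close>
  has fewer than \<open>m\<close> roots; multiplication by \<open>\<xi>\<close> permutes the summands.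
\<close>

lemma sum_roots_unity:
  "(\<Sum>\<zeta> | \<zeta> ^ m = 1. \<zeta> ^ k) = (if m dvd k then of_nat m else (0::'k))"
proof (cases "m dvd k")
  case True
  then obtain l where "k = m * l" by auto
  then have "\<zeta> ^ k = 1" if "\<zeta> ^ m = (1::'k)" for \<zeta> using that by (simp add: power_mult)
  then show ?thesis using True by (simp add: card_roots_unity)
next
  case False
  define l where "l = k mod m"
  have l: "0 < l" "l < m" using False m_pos by (auto simp: l_def dvd_eq_mod_eq_0)
  have power: "\<zeta> ^ k = \<zeta> ^ l" if "\<zeta> ^ m = (1::'k)" for \<zeta>
  proof -
    have "\<zeta> ^ k = \<zeta> ^ (m * (k div m) + l)" by (simp add: l_def)
    then show ?thesis using that by (simp add: power_add power_mult)
  qed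
  have "\<exists>\<xi>. \<xi> ^ m = (1::'k) \<and> \<xi> ^ k \<noteq> 1"
  proof (rule ccontr)
    assume contra: "\<not> ?thesis"
    define r :: "'k poly" where "r = monom 1 l - 1"
    have "degree r = l" "r \<noteq> 0"
    proof -
      have "coeff r l = 1" using l by (simp add: r_def coeff_1)
      then show "r \<noteq> 0" by auto
      have "l \<le> degree r" using \<open>coeff r l = 1\<close> by (intro le_degree) simp
      moreover have "degree r \<le> l"
        unfolding r_def using l by (intro degree_diff_le) (auto simp: degree_monom_le)
      ultimately show "degree r = l" by simp
    qed
    have "{\<zeta>. \<zeta> ^ m = 1} \<subseteq> {\<zeta>. poly r \<zeta> = 0}"
    proof clarify
      fix \<zeta> :: 'k assume "\<zeta> ^ m = 1"
      then have "\<zeta> ^ l = 1" using contra power by metis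
      then show "poly r \<zeta> = 0" by (simp add: r_def poly_monom)
    qed
    then have "card {\<zeta>::'k. \<zeta> ^ m = 1} \<le> card {\<zeta>. poly r \<zeta> = 0}"
      using poly_roots_finite[OF \<open>r \<noteq> 0\<close>] by (intro card_mono)
    also have "\<dots> \<le> degree r" using \<open>r \<noteq> 0\<close> by (rule card_poly_roots_bound)
    finally show False using card_roots_unity l \<open>degree r = l\<close> by simp
  qed
  then obtain \<xi> :: 'k where \<xi>: "\<xi> ^ m = 1" "\<xi> ^ k \<noteq> 1" by blast
  have "\<xi> \<noteq> 0" using \<xi>(1) m_pos by (auto simp: zero_power)
  have "(\<Sum>\<zeta> | \<zeta> ^ m = 1. \<zeta> ^ k) = (\<Sum>\<zeta> | \<zeta> ^ m = 1. (\<xi> * \<zeta>) ^ k)"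
    by (rule sum.reindex_bij_witness[of _ "\<lambda>\<zeta>. \<xi> * \<zeta>" "\<lambda>\<zeta>. \<zeta> / \<xi>"])
      (use \<xi> \<open>\<xi> \<noteq> 0\<close> in \<open>auto simp: power_mult_distrib power_divide\<close>)
  also have "\<dots> = \<xi> ^ k * (\<Sum>\<zeta> | \<zeta> ^ m = 1. \<zeta> ^ k)"
    by (simp add: power_mult_distrib sum_distrib_left)
  finally have "(1 - \<xi> ^ k) * (\<Sum>\<zeta> | \<zeta> ^ m = 1. \<zeta> ^ k) = 0" by (simp add: algebra_simps)
  then show ?thesis using \<xi> False by simp
qed

lemma finite_roots_unity: "finite {\<zeta>::'k. \<zeta> ^ m = 1}"
  using card_roots_unity m_pos by (metis card.infinite less_irrefl)

text \<open>
  Averaging over the Galois group isolates a monomial component, so bounds on the values of all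
  conjugates of \<open>f\<close> pass to the components.
\<close>

lemma component_value_ge:
  assumes P: "point emb P" and f: "f = (\<Sum>i<m. ratfun (c i) * z ^ i)"
    and ge: "\<And>\<zeta>. \<zeta> ^ m = 1 \<Longrightarrow> v \<le> P (twist \<zeta> f)" and "f \<noteq> 0"
    and j: "j < m" "c j \<noteq> 0"
  shows "v \<le> P (ratfun (c j) * z ^ j)"
proof -
  interpret place emb P by standard (rule P)
  let ?U = "{\<zeta>::'k. \<zeta> ^ m = 1}"
  have "(\<Sum>\<zeta>\<in>?U. emb (\<zeta> ^ (m - j)) * twist \<zeta> f) =
      (\<Sum>\<zeta>\<in>?U. \<Sum>i<m. emb (\<zeta> ^ (m - j + i)) * (ratfun (c i) * z ^ i))"
  proof (intro sum.cong refl)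
    fix \<zeta> :: 'k assume "\<zeta> \<in> ?U"
    then have "twist \<zeta> f = (\<Sum>i<m. emb \<zeta> ^ i * (ratfun (c i) * z ^ i))"
      unfolding f by (intro twist_sum) simp
    then show "emb (\<zeta> ^ (m - j)) * twist \<zeta> f =
        (\<Sum>i<m. emb (\<zeta> ^ (m - j + i)) * (ratfun (c i) * z ^ i))"
      by (simp add: sum_distrib_left emb_power emb_mult power_add mult_ac)
  qed
  also have "\<dots> = (\<Sum>i<m. \<Sum>\<zeta>\<in>?U. emb (\<zeta> ^ (m - j + i)) * (ratfun (c i) * z ^ i))"
    by (rule sum.swap)
  also have "\<dots> = (\<Sum>i<m. emb (\<Sum>\<zeta>\<in>?U. \<zeta> ^ (m - j + i)) * (ratfun (c i) * z ^ i))"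
    by (simp add: emb_sum sum_distrib_right)
  also have "\<dots> = (\<Sum>i<m. if i = j then emb (of_nat m) * (ratfun (c j) * z ^ j) else 0)"
  proof (intro sum.cong refl)
    fix i assume "i \<in> {..<m}"
    then have "m dvd m - j + i \<longleftrightarrow> i = j"
    proof -
      have "m - j + i < 2 * m" "0 < m - j + i" using \<open>i \<in> _\<close> j by auto
      then have "m dvd m - j + i \<longleftrightarrow> m - j + i = m"
        by (auto elim!: dvdE simp: less_2_cases_iff dest: less_2_cases)
      then show ?thesis using j by auto
    qed
    then show "emb (\<Sum>\<zeta>\<in>?U. \<zeta> ^ (m - j + i)) * (ratfun (c i) * z ^ i) =
        (if i = j then emb (of_nat m) * (ratfun (c j) * z ^ j) else 0)"
      by (simp add: sum_roots_unity)
  qed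
  also have "\<dots> = emb (of_nat m) * (ratfun (c j) * z ^ j)" using j by simp
  finally have avg: "(\<Sum>\<zeta>\<in>?U. emb (\<zeta> ^ (m - j)) * twist \<zeta> f) = emb (of_nat m) * (ratfun (c j) * z ^ j)" .
  have "v \<le> P (\<Sum>\<zeta>\<in>?U. emb (\<zeta> ^ (m - j)) * twist \<zeta> f)"
  proof (rule value_sum_ge)
    fix \<zeta> :: 'k assume \<zeta>: "\<zeta> \<in> ?U"
    then have "\<zeta> \<noteq> 0" using m_pos by (auto simp: zero_power)
    then show "v \<le> P (emb (\<zeta> ^ (m - j)) * twist \<zeta> f)"
      using ge \<zeta> twist_eq_0_iff[of \<zeta> f] \<open>f \<noteq> 0\<close> by (simp add: value_mult)
  next
    show "(\<Sum>\<zeta>\<in>?U. emb (\<zeta> ^ (m - j)) * twist \<zeta> f) \<noteq> 0"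
      unfolding avg using j char_not_dvd z_nz by simp
  qed (rule finite_roots_unity)
  then show ?thesis
    unfolding avg using j char_not_dvd z_nz by (simp add: value_mult)
qed

section \<open>Totally ramified places\<close>

lemma ramified_values:
  assumes "has_ramification_index emb (adjoin emb {x}) P m"
  shows "int m dvd P (ratfun g)" "\<exists>g. g \<noteq> 0 \<and> P (ratfun g) = int m"
proof -
  obtain Q where Q: "is_place emb (range ratfun) Q" "\<And>f. f \<in> range ratfun \<Longrightarrow> P f = int m * Q f"
    using assms by (auto simp: has_ramification_index_def adjoin_eq_range_ratfun)
  then show "int m dvd P (ratfun g)" by simp
  obtain f where "f \<in> range ratfun - {0}" "Q f = 1" using Q(1) by (auto simp: is_place_def)
  then show "\<exists>g. g \<noteq> 0 \<and> P (ratfun g) = int m" using Q(2) by auto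
qed

text \<open>
  Modulo \<open>m\<close>, the value of \<open>g u ^ i\<close> is \<open>i\<close> when \<open>u\<close> is a local parameter of a place totally ramified
  over the rational function field.
\<close>

lemma ramified_distinct_values:
  assumes P: "point emb P" and dvd: "\<And>g. int m dvd P (ratfun g)" and u: "u \<noteq> 0" "P u = 1"
    and hyps: "i < m" "j < m" "i \<noteq> j" "g \<noteq> 0" "h \<noteq> 0"
  shows "P (ratfun g * u ^ i) \<noteq> P (ratfun h * u ^ j)"
proof
  interpret place emb P by standard (rule P)
  assume "P (ratfun g * u ^ i) = P (ratfun h * u ^ j)"
  then have "P (ratfun h) - P (ratfun g) = int i - int j"
    using u hyps by (simp add: value_mult value_power)
  then have "int m dvd int i - int j" using dvd by (metis dvd_diff)
  moreover have "\<bar>int i - int j\<bar> < int m" "int i - int j \<noteq> 0" using hyps by auto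
  ultimately show False using dvd_imp_le_int[of "int i - int j" "int m"] by simp
qed

text \<open>
  There is only one place above the place below a totally ramified one.  The powers of a local
  parameter \<open>u\<close> with exponents below \<open>m\<close> have values that are distinct modulo \<open>m\<close>, hence they form
  a basis, and \<open>u ^ m\<close> is a combination of them of Eisenstein type.  The latter forces
  the value of \<open>u\<close> at any other place \<open>P'\<close> above the same place to be positive, and then the values
  of all functions at \<open>P'\<close> are determined.
\<close>

lemma totally_ramified_unique:
  assumes P: "point emb P" and dvd: "\<And>g. int m dvd P (ratfun g)"
    and P': "point emb P'" and e: "0 < e"
    and above: "\<And>g. g \<noteq> 0 \<Longrightarrow> int m * P' (ratfun g) = e * P (ratfun g)"
  shows "P' = P"
proof -
  interpret place emb P by standard (rule P)
  interpret P': place emb P' by standard (rule P')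
  obtain u where u: "u \<noteq> 0" "P u = 1" using uniformizer by blast
  have value_term: "P (ratfun g * u ^ i) = P (ratfun g) + int i" if "g \<noteq> 0" for g i
    using that u by (simp add: value_mult value_power)
  note distinct = ramified_distinct_values[OF P dvd u]
  have span: "\<exists>c. f = (\<Sum>i<m. ratfun (c i) * u ^ i)" for f
  proof (rule independent_imp_span[of "\<lambda>i. u ^ i" f])
    fix c i assume "(\<Sum>i<m. ratfun (c i) * u ^ i) = 0" "i < m"
    then show "c i = 0"
      using u distinct by (intro independent_of_distinct_values[OF P, of "\<lambda>i. u ^ i" c i]) auto
  qed blast
  have minimal_term: "\<exists>i<m. c i \<noteq> 0 \<and> P (\<Sum>i<m. ratfun (c i) * u ^ i) = P (ratfun (c i)) + int i \<and>
      (\<forall>j<m. c j \<noteq> 0 \<longrightarrow> P (ratfun (c i)) + int i \<le> P (ratfun (c j)) + int j)"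
    if "(\<Sum>i<m. ratfun (c i) * u ^ i) \<noteq> 0" for c
  proof -
    obtain i0 where i0: "i0 < m" "c i0 \<noteq> 0"
    proof (rule ccontr)
      assume "\<not> thesis"
      then have "\<forall>i<m. c i = 0" using that by blast
      then show False using \<open>(\<Sum>i<m. ratfun (c i) * u ^ i) \<noteq> 0\<close> by simp
    qed
    obtain i where "i \<in> {..<m}" "ratfun (c i) * u ^ i \<noteq> 0"
      "P (\<Sum>i<m. ratfun (c i) * u ^ i) = P (ratfun (c i) * u ^ i)"
      "\<And>j. j \<in> {..<m} \<Longrightarrow> ratfun (c j) * u ^ j \<noteq> 0 \<Longrightarrow> P (ratfun (c i) * u ^ i) \<le> P (ratfun (c j) * u ^ j)"
      by (rule value_sum_distinct[of "{..<m}" i0 "\<lambda>i. ratfun (c i) * u ^ i"])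
        (use i0 u distinct in auto)
    then show ?thesis using value_term u by (intro exI[of _ i]) auto
  qed

  obtain d where d: "u ^ m = (\<Sum>i<m. ratfun (d i) * u ^ i)" using span by blast
  obtain i where i: "i < m" "d i \<noteq> 0" "int m = P (ratfun (d i)) + int i"
    and least: "\<And>j. j < m \<Longrightarrow> d j \<noteq> 0 \<Longrightarrow> int m \<le> P (ratfun (d j)) + int j"
    using minimal_term[of d] u value_power[of u m] unfolding d[symmetric] by auto
  have "int i = int m - P (ratfun (d i))" using i by simp
  then have "int m dvd int i" using dvd by simp
  then have "i = 0" using i(1) by (meson int_dvd_int_iff nat_dvd_not_less neq0_conv)
  then have d0: "d 0 \<noteq> 0" "P' (ratfun (d 0)) = e"
    using i above[of "d 0"] m_pos by auto
  have dj: "e \<le> P' (ratfun (d j))" if "j < m" "d j \<noteq> 0" for j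
  proof -
    have "0 < P (ratfun (d j))" using least[OF that] that by simp
    then have "int m \<le> P (ratfun (d j))" using dvd zdvd_imp_le by blast
    then have "e * int m \<le> int m * P' (ratfun (d j))" using above[OF that(2)] e by simp
    then show ?thesis using m_pos by (simp add: mult.commute)
  qed
  \<comment> \<open>The equation of \<open>u\<close> is of Eisenstein type at \<open>P'\<close> too, but the value of \<open>u\<close> is not yet known.\<close>
  define l where "l = P' u"
  have um: "P' (u ^ m) = int m * l" using u by (simp add: P'.value_power l_def)
  have value_term': "P' (ratfun g * u ^ j) = P' (ratfun g) + int j * l" if "g \<noteq> 0" for g j
    using that u by (simp add: P'.value_mult P'.value_power l_def)
  have "0 < l"
  proof (rule ccontr)
    assume "\<not> 0 < l"
    have "e + int (m - 1) * l \<le> P' (\<Sum>i<m. ratfun (d i) * u ^ i)"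
    proof (rule P'.value_sum_ge)
      fix j assume j: "j \<in> {..<m}" "ratfun (d j) * u ^ j \<noteq> 0"
      then have "int (m - 1) * l \<le> int j * l"
        using \<open>\<not> 0 < l\<close> by (intro mult_right_mono_neg) auto
      then show "e + int (m - 1) * l \<le> P' (ratfun (d j) * u ^ j)"
        using dj[of j] j value_term'[of "d j" j] by auto
    qed (use d u in \<open>auto simp flip: d\<close>)
    then have "e + int (m - 1) * l \<le> int m * l" using um d by simp
    then have "e \<le> l" using m_pos by (simp add: of_nat_diff algebra_simps)
    then show False using e \<open>\<not> 0 < l\<close> by simp
  qed
  have "u ^ m = ratfun (d 0) + (\<Sum>j\<in>{..<m} - {0}. ratfun (d j) * u ^ j)"
    unfolding d using m_pos by (simp add: sum.remove[of "{..<m}" 0])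
  moreover have "(\<Sum>j\<in>{..<m} - {0}. ratfun (d j) * u ^ j) = 0 \<or>
      e + 1 \<le> P' (\<Sum>j\<in>{..<m} - {0}. ratfun (d j) * u ^ j)"
  proof (rule disjCI, rule ccontr)
    assume not_ge: "\<not> e + 1 \<le> P' (\<Sum>j\<in>{..<m} - {0}. ratfun (d j) * u ^ j)"
      and nz: "(\<Sum>j\<in>{..<m} - {0}. ratfun (d j) * u ^ j) \<noteq> 0"
    have "e + 1 \<le> P' (\<Sum>j\<in>{..<m} - {0}. ratfun (d j) * u ^ j)"
    proof (rule P'.value_sum_ge)
      fix j assume j: "j \<in> {..<m} - {0}" "ratfun (d j) * u ^ j \<noteq> 0"
      then have "1 * 1 \<le> int j * l" using \<open>0 < l\<close> by (intro mult_mono) auto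
      then show "e + 1 \<le> P' (ratfun (d j) * u ^ j)"
        using dj[of j] j value_term'[of "d j" j] by auto
    qed (use nz in auto)
    then show False using not_ge by simp
  qed
  ultimately have "P' (u ^ m) = e"
    using P'.value_add_eq[of "ratfun (d 0)" "\<Sum>j\<in>{..<m} - {0}. ratfun (d j) * u ^ j"] d0 by auto
  then have ml: "e = int m * l" using um by simp
  have scaled: "P' (ratfun g) = l * P (ratfun g)" if "g \<noteq> 0" for g
    using above[OF that] m_pos by (simp add: ml)
  have scale: "P' f = l * P f" if f: "f \<noteq> 0" for f
  proof -
    obtain c where c: "f = (\<Sum>i<m. ratfun (c i) * u ^ i)" using span by blast
    obtain i where i: "i < m" "c i \<noteq> 0" "P f = P (ratfun (c i)) + int i"
      "\<And>j. j < m \<Longrightarrow> c j \<noteq> 0 \<Longrightarrow> P (ratfun (c i)) + int i \<le> P (ratfun (c j)) + int j"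
      using minimal_term[of c] f unfolding c[symmetric] by auto
    have scaled_term: "P' (ratfun (c j) * u ^ j) = l * P (ratfun (c j) * u ^ j)" if "c j \<noteq> 0" for j
      using that by (simp add: value_term' value_term scaled distrib_left mult.commute[of l "int j"])
    obtain k where k: "k \<in> {..<m}" "ratfun (c k) * u ^ k \<noteq> 0" "P' f = P' (ratfun (c k) * u ^ k)"
      "\<And>j. j \<in> {..<m} \<Longrightarrow> ratfun (c j) * u ^ j \<noteq> 0 \<Longrightarrow> P' (ratfun (c k) * u ^ k) \<le> P' (ratfun (c j) * u ^ j)"
    proof (rule P'.value_sum_distinct[of "{..<m}" i "\<lambda>i. ratfun (c i) * u ^ i"])
      fix j k assume "j \<in> {..<m}" "k \<in> {..<m}" "j \<noteq> k" "ratfun (c j) * u ^ j \<noteq> 0" "ratfun (c k) * u ^ k \<noteq> 0"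
      then show "P' (ratfun (c j) * u ^ j) \<noteq> P' (ratfun (c k) * u ^ k)"
        using distinct[of j k "c j" "c k"] scaled_term \<open>0 < l\<close> by auto
    qed (use i u c in auto)
    have "c k \<noteq> 0" using k(2) by auto
    have "l * P (ratfun (c k) * u ^ k) \<le> l * P (ratfun (c i) * u ^ i)"
      using k(4)[of i] i(1,2) u scaled_term[OF i(2)] scaled_term[OF \<open>c k \<noteq> 0\<close>] by simp
    then have "P (ratfun (c k) * u ^ k) \<le> P f"
      using \<open>0 < l\<close> i(3) value_term[OF i(2)] by simp
    moreover have "P f \<le> P (ratfun (c k) * u ^ k)"
      using i(3,4) k(1) \<open>c k \<noteq> 0\<close> value_term[OF \<open>c k \<noteq> 0\<close>] by simp
    ultimately show ?thesis using k(3) scaled_term[OF \<open>c k \<noteq> 0\<close>] by simp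
  qed
  obtain u' where "u' \<noteq> 0" "P' u' = 1" using P'.uniformizer by blast
  then have "l * P u' = 1" using scale by simp
  then have "l = 1" using \<open>0 < l\<close> by (simp add: zmult_eq_1_iff)
  then show "P' = P" using scale by (intro ext) (metis P'.value_zero value_zero mult_1)
qed

text \<open>
  The conjugates of a place lie above the same place of the rational function field, so a totally
  ramified place is invariant under the Galois group.
\<close>

lemma ramified_twist:
  assumes "point emb P" "has_ramification_index emb (adjoin emb {x}) P m" "\<zeta> ^ m = 1"
  shows "P (twist \<zeta> f) = P f"
proof -
  have "(\<lambda>f. P (twist \<zeta> f)) = P"
    using point_twist[OF assms(1,3)] ramified_values(1)[OF assms(2)] m_pos
    by (intro totally_ramified_unique[OF assms(1), where e = "int m"])
      (auto simp: twist_ratfun assms(3))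
  then show ?thesis by metis
qed

text \<open>
  Any two poles of \<open>x\<close> lie above the place of the rational function field given by the degree.
\<close>

lemma ramified_pole_unique:
  assumes P: "point emb P" "has_ramification_index emb (adjoin emb {x}) P m" "P x < 0"
  shows "P = P_inf"
proof -
  obtain g where g: "g \<noteq> 0" "P (ratfun g) = int m" using ramified_values(2)[OF P(2)] by blast
  obtain k where "P (ratfun g) = k * P x" using value_ratfun_pole[OF P(1,3) g(1)] .
  then have "P x dvd int m" using g by simp
  moreover have "int m dvd P x"
    using ramified_values(1)[OF P(2), of "Fract [:0, 1:] 1"] by (simp add: ratfun_poly)
  ultimately have "\<bar>P x\<bar> = int m" by (simp add: zdvd_antisym_abs)
  then have Px: "P x = - int m" using P(3) by simp
  have "P_inf = P"
  proof (rule totally_ramified_unique[OF P(1) ramified_values(1)[OF P(2)] P_inf(1)])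
    show "0 < - P_inf x" using P_inf(2) by simp
    fix g :: "'k poly fract" assume "g \<noteq> 0"
    obtain r s where g: "g = Fract r s" "s \<noteq> 0" by (metis Fract_cases)
    then have "r \<noteq> 0" using \<open>g \<noteq> 0\<close> by (auto simp: fract_collapse)
    then show "int m * P_inf (ratfun g) = - P_inf x * P (ratfun g)"
      using g Px P_inf(2) P
      by (simp add: value_ratfun_Fract[OF P(1)] value_ratfun_Fract[OF P_inf(1)]
          value_poly_pole[OF P(1,3)] value_poly_pole[OF P_inf] algebra_simps)
  qed
  then show ?thesis ..
qed

lemma ramified_value_linear:
  assumes P: "point emb P" "has_ramification_index emb (adjoin emb {x}) P m" "0 < P (x - emb a)"
  shows "P (x - emb a) = int m"
proof -
  have "x - emb a = ratfun (Fract [:- a, 1:] 1)" by (simp add: ratfun_poly emb_uminus)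
  then have "int m dvd P (x - emb a)" using ramified_values(1)[OF P(2)] by simp
  moreover have "P (x - emb a) dvd int m"
  proof -
    obtain g where g: "g \<noteq> 0" "P (ratfun g) = int m" using ramified_values(2)[OF P(2)] by blast
    obtain r s where rs: "g = Fract r s" "s \<noteq> 0" by (metis Fract_cases)
    then have "r \<noteq> 0" using \<open>g \<noteq> 0\<close> by (auto simp: fract_collapse)
    then have "P (ratfun g) = (int (order a r) - int (order a s)) * P (x - emb a)"
      using rs by (simp add: value_ratfun_Fract[OF P(1)] value_poly_zero[OF P(1,3)] algebra_simps)
    then show ?thesis using g by simp
  qed
  ultimately show ?thesis using P(3) by (simp add: zdvd_antisym_nonneg)
qed

end

section \<open>Roots of unity in finite fields\<close>

lemma card_power_eq_le:
  assumes "0 < l"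
  shows "finite {k::'k::field. k ^ l = u}" "card {k::'k::field. k ^ l = u} \<le> l"
proof -
  define r where "r = monom 1 l + [:- u:]"
  have "degree r = l"
    using assms degree_add_eq_left[of "[:- u:]" "monom 1 l"] by (simp add: r_def degree_monom_eq)
  then have "r \<noteq> 0" using assms by auto
  have "{k. k ^ l = u} = {k. poly r k = 0}" by (auto simp: r_def poly_monom)
  then show "finite {k::'k::field. k ^ l = u}" "card {k::'k::field. k ^ l = u} \<le> l"
    using poly_roots_finite[OF \<open>r \<noteq> 0\<close>] card_poly_roots_bound[OF \<open>r \<noteq> 0\<close>] \<open>degree r = l\<close> by auto
qed

context
  assumes finite_K: "finite (UNIV :: 'k::field set)"
begin

lemma nonzero_power_card: "k \<noteq> 0 \<Longrightarrow> (k::'k) ^ (CARD('k) - 1) = 1"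
proof -
  assume k: "k \<noteq> 0"
  have fin: "finite (UNIV - {0::'k})" using finite_K by simp
  have "(\<Prod>a\<in>UNIV - {0}. a) = (\<Prod>a\<in>UNIV - {0}. k * a)"
    by (rule prod.reindex_bij_witness[of _ "\<lambda>a. k * a" "\<lambda>a. a / k"]) (use k in auto)
  also have "\<dots> = k ^ card (UNIV - {0::'k}) * (\<Prod>a\<in>UNIV - {0}. a)"
    by (simp add: prod.distrib)
  finally have "k ^ card (UNIV - {0::'k}) = 1" using fin by simp
  then show "k ^ (CARD('k) - 1) = 1" using finite_K by (simp add: card_Diff_singleton)
qed

lemma of_nat_card_eq_0: "of_nat CARD('k) = (0::'k)"
proof -
  have "(\<Sum>a\<in>(UNIV::'k set). a) = (\<Sum>a\<in>UNIV. a + 1)"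
    by (rule sum.reindex_bij_witness[of _ "\<lambda>a. a + 1" "\<lambda>a. a - 1"]) auto
  also have "\<dots> = (\<Sum>a\<in>UNIV. a) + of_nat CARD('k)"
    by (simp add: sum.distrib)
  finally show ?thesis by simp
qed

text \<open>
  The power map with exponent \<open>(CARD('k) - 1) / m\<close> sends the nonzero elements to the \<open>m\<close>-th roots
  of unity and has small fibres, so there are as many roots of unity as there can be.
\<close>

lemma card_roots_unity_finite_field:
  assumes "m dvd CARD('k) - 1" "0 < m"
  shows "card {\<zeta>::'k. \<zeta> ^ m = 1} = m"
proof (rule antisym)
  show "card {\<zeta>::'k. \<zeta> ^ m = 1} \<le> m" using card_power_eq_le[OF assms(2)] by blast
  obtain l where l: "CARD('k) - 1 = m * l" using assms by auto
  have "card {0, 1::'k} \<le> CARD('k)" using finite_K by (intro card_mono) auto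
  then have "0 < l" using l by (cases l) auto
  define U where "U = {\<zeta>::'k. \<zeta> ^ m = 1}"
  have "finite U" unfolding U_def by (rule card_power_eq_le[OF assms(2)])
  have "UNIV - {0::'k} \<subseteq> (\<Union>u\<in>U. {k. k ^ l = u})"
  proof
    fix k :: 'k assume "k \<in> UNIV - {0}"
    then have "(k ^ l) ^ m = 1"
      using nonzero_power_card[of k] l by (simp add: mult.commute flip: power_mult)
    then show "k \<in> (\<Union>u\<in>U. {k. k ^ l = u})" by (simp add: U_def)
  qed
  then have "card (UNIV - {0::'k}) \<le> card (\<Union>u\<in>U. {k. k ^ l = u})"
    using \<open>finite U\<close> card_power_eq_le[OF \<open>0 < l\<close>] by (intro card_mono) auto
  also have "\<dots> \<le> (\<Sum>u\<in>U. card {k. k ^ l = u})" using \<open>finite U\<close> by (rule card_UN_le)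
  also have "\<dots> \<le> (\<Sum>u\<in>U. l)" by (intro sum_mono card_power_eq_le[OF \<open>0 < l\<close>])
  finally have "m * l \<le> card U * l" using l finite_K by (simp add: card_Diff_singleton)
  then show "m \<le> card {\<zeta>::'k. \<zeta> ^ m = 1}" using \<open>0 < l\<close> by (simp add: U_def)
qed

end

section \<open>The function field of the curve\<close>

lemma Suc_dvd_odd_power: "odd n \<Longrightarrow> (q + 1) dvd (q ^ n + 1 :: nat)"
proof (elim oddE)
  fix k assume "n = 2 * k + 1"
  have "(int q + 1) dvd int q ^ (2 * k + 1) + 1"
  proof (induction k)
    case (Suc k)
    have "int q ^ (2 * Suc k + 1) + 1 = int q ^ 2 * (int q ^ (2 * k + 1) + 1) - (int q + 1) * (int q - 1)"
      by (simp add: algebra_simps power2_eq_square)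
    then show ?case using Suc by (metis dvd_diff dvd_mult dvd_triv_left)
  qed simp
  then have "int (q + 1) dvd int (q ^ n + 1)" using \<open>n = _\<close> by (simp add: add.commute)
  then show ?thesis by (simp only: int_dvd_int_iff)
qed

context curve_X
begin

sublocale ratfun_field emb x
  by standard (rule emb, rule x_transcendental)

text \<open>
  In these terms, the plane model is \<open>z ^ m = \<kappa> t s ^ (q + 1)\<close> with a constant \<open>\<kappa> = \<plusminus> 1 / c\<close>; the degree
  of \<open>t\<close> is \<open>d\<close>, and \<open>m = (q + 1) M\<close>.
\<close>

definition t :: "'k poly" where
  "t = (\<Sum>i<a div b. monom 1 (p ^ (i * b)))"

definition s :: "'k poly" where
  "s = t ^ (q - 1) + 1"

definition d :: nat where
  "d = p ^ (a - b)"

definition m :: nat where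
  "m = q ^ n + 1"

definition M :: nat where
  "M = m div (q + 1)"

lemma ev_t: "ev x t = t_poly p a b x"
  by (simp add: t_def t_poly_def ev_sum ev_monom)

lemma p_ge_2: "2 \<le> p"
  using prime_p by (rule prime_ge_2_nat)

lemma b_le_a: "b \<le> a"
  using b_dvd_a a_pos by (auto dest: dvd_imp_le)

lemma q_eq_d: "q = p ^ b * d"
  using b_le_a by (simp add: q_eq d_def flip: power_add)

lemma d_pos: "1 \<le> d"
  using p_ge_2 by (simp add: d_def)

lemma two_d_le_q: "2 * d \<le> q"
proof -
  have "p \<le> p ^ b" using p_ge_2 b_pos by (intro self_le_power) auto
  then have "2 \<le> p ^ b" using p_ge_2 by simp
  then show ?thesis by (simp add: q_eq_d)
qed

lemma q_ge_2: "2 \<le> q"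
  using two_d_le_q d_pos by simp

lemma M_eq: "M * (q + 1) = m"
  unfolding M_def m_def by (rule dvd_div_mult_self[OF Suc_dvd_odd_power[OF n_odd]])

lemma m_pos: "0 < m" and M_pos: "0 < M" and M_less: "M < m"
proof -
  show "0 < m" by (simp add: m_def)
  then show "0 < M" using M_eq by (cases M) auto
  then have "M < M * (q + 1)" using q_ge_2 by simp
  then show "M < m" by (simp only: M_eq)
qed

lemma finite_K: "finite (UNIV :: 'k set)"
proof (rule ccontr)
  assume "infinite (UNIV :: 'k set)"
  then show False using card_K q_ge_2 by simp
qed

lemma of_nat_q: "of_nat q = (0::'k)"
  using of_nat_card_eq_0[OF finite_K] by (simp add: card_K)

lemma of_nat_p: "of_nat p = (0::'k)"
  using of_nat_q by (simp add: q_eq)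

lemma of_nat_m: "of_nat m = (1::'k)"
  using of_nat_q n_ge by (simp add: m_def)

lemma m_dvd_card: "m dvd CARD('k) - 1"
proof -
  have "q ^ (2 * n) - 1 = (q ^ n + 1) * (q ^ n - 1)"
    by (simp add: power_mult power2_eq_square algebra_simps mult_2 power_add)
  then show ?thesis by (simp only: card_K m_def dvd_triv_left)
qed

lemma card_roots_m: "card {\<zeta>::'k. \<zeta> ^ m = 1} = m"
  by (rule card_roots_unity_finite_field[OF finite_K m_dvd_card m_pos])

lemma c_nz: "c \<noteq> 0"
  using c_pow q_ge_2 by (auto simp: zero_power)

text \<open>All exponents but the first are divisible by the characteristic.\<close>

lemma pderiv_t: "pderiv t = 1"
proof -
  have sum: "pderiv (\<Sum>i\<in>I. f i) = (\<Sum>i\<in>I. pderiv (f i))" for I and f :: "nat \<Rightarrow> 'k poly"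
    by (induction I rule: infinite_finite_induct) (auto simp: pderiv_add)
  have "pderiv (monom 1 (p ^ (i * b)) :: 'k poly) = (if i = 0 then 1 else 0)" for i
    using of_nat_p b_pos by (auto simp: pderiv_monom)
  moreover have "0 < a div b" using b_le_a b_pos by (simp add: div_greater_zero_iff)
  ultimately show ?thesis by (simp add: t_def sum)
qed

lemma t_nz: "t \<noteq> 0"
  using pderiv_t by auto

lemma degree_t: "degree t = d"
proof (rule antisym)
  have "0 < a div b" using b_le_a b_pos by (simp add: div_greater_zero_iff)
  then obtain k where k: "a div b = Suc k" by (cases "a div b") auto
  have "a = Suc k * b" using b_dvd_a k by (metis dvd_div_mult_self)
  then have "a - b = k * b" by simp
  then have d: "d = p ^ (k * b)" unfolding d_def by (rule arg_cong)
  have pow_le: "p ^ (i * b) \<le> p ^ (k * b)" if "i \<le> k" for i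
    using p_ge_2 that by (intro power_increasing) auto
  show "degree t \<le> d"
    unfolding t_def k d by (intro degree_sum_le) (auto simp: degree_monom_eq pow_le)
  have "coeff t d = (\<Sum>i<Suc k. if i = k then 1 else 0)"
    unfolding t_def k d coeff_sum coeff_monom
    using p_ge_2 b_pos by (intro sum.cong refl) auto
  then show "d \<le> degree t" by (intro le_degree) simp
qed

text \<open>The product is \<open>t ^ q + t\<close>, and the derivative of a \<open>q\<close>-th power vanishes.\<close>

lemma pderiv_ts: "pderiv (t * s) = 1"
proof -
  have "t ^ q = t * t ^ (q - 1)" using q_ge_2 by (simp flip: power_Suc)
  then have "t * s = t ^ q + t" by (simp add: s_def algebra_simps)
  then show ?thesis by (simp add: pderiv_add pderiv_power of_nat_q pderiv_t)
qed

lemma s_nz: "s \<noteq> 0"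
  using pderiv_ts by auto

lemma degree_s: "degree s = (q - 1) * d"
proof -
  have "0 < degree (t ^ (q - 1))"
    using degree_t q_ge_2 d_pos t_nz by (simp add: degree_power_eq)
  then have "degree s = degree (t ^ (q - 1))" unfolding s_def by (intro degree_add_eq_left) simp
  then show ?thesis using degree_t t_nz by (simp add: degree_power_eq)
qed

lemma y_nz: "y \<noteq> 0"
  using eq_y t_nz by (auto simp flip: ev_t)

text \<open>
  Since \<open>c ^ (q - 1) = - 1\<close>, raising \<open>y ^ (q + 1) = t / c\<close> to the power \<open>q - 1\<close> gives
  \<open>y ^ (q\<^sup>2 - 1) = - t ^ (q - 1)\<close>.
\<close>

lemma z_pow_M: "z ^ M = - y * ev x s"
proof -
  have y_pow: "y ^ (q + 1) = ev x t / emb c" using eq_y c_nz by (simp add: ev_t field_simps)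
  have "(q + 1) * (q - 1) + 1 = q\<^sup>2"
    using q_ge_2 by (cases q) (auto simp: power2_eq_square)
  then have "y ^ (q\<^sup>2) = (y ^ (q + 1)) ^ (q - 1) * y" by (metis power_add power_mult power_one_right)
  also have "(y ^ (q + 1)) ^ (q - 1) = ev x t ^ (q - 1) / emb (c ^ (q - 1))"
    unfolding y_pow by (simp only: power_divide emb_power)
  also have "\<dots> = - (ev x t ^ (q - 1))" unfolding c_pow by (simp add: emb_uminus)
  finally have y_q2: "y ^ (q\<^sup>2) = - (ev x t ^ (q - 1)) * y" .
  have "z ^ M = - (ev x t ^ (q - 1)) * y - y" by (simp only: M_def m_def eq_z y_q2)
  also have "\<dots> = - y * ev x s" by (simp add: s_def ev_add ev_power algebra_simps)
  finally show ?thesis .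
qed

definition H :: "'k poly" where
  "H = smult ((- 1) ^ (q + 1) / c) (t * s ^ (q + 1))"

lemma z_pow_m: "z ^ m = ev x H"
proof -
  have "z ^ m = (z ^ M) ^ (q + 1)" unfolding M_eq[symmetric] by (rule power_mult)
  also have "\<dots> = (- 1) ^ (q + 1) * (y ^ (q + 1) * ev x s ^ (q + 1))"
  proof -
    have "z ^ M = - 1 * (y * ev x s)" by (simp add: z_pow_M)
    then show ?thesis by (simp only: power_mult_distrib)
  qed
  also have "y ^ (q + 1) = ev x t / emb c" using eq_y c_nz by (simp add: ev_t field_simps)
  finally show ?thesis
    unfolding H_def ev_smult ev_mult ev_power emb_divide emb_power emb_uminus emb_one by simp
qed

lemma H_nz: "H \<noteq> 0"
  using t_nz s_nz c_nz by (simp add: H_def)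

lemma degree_H: "degree H = q\<^sup>2 * d"
proof -
  have "degree H = d + (q + 1) * ((q - 1) * d)"
    using t_nz s_nz c_nz unfolding H_def
    by (simp add: degree_mult_eq degree_power_eq degree_t degree_s del: power_Suc)
  then show ?thesis using q_ge_2 by (cases q) (auto simp: power2_eq_square algebra_simps)
qed

lemma coprime_degree_H: "coprime (degree H) m"
proof -
  have "coprime (q ^ n) (q ^ n + 1)" by simp
  then have "coprime q (q ^ n + 1) \<or> n = 0" by (simp only: coprime_power_left_iff)
  then have "coprime q (q ^ n + 1)" using n_ge by simp
  moreover have "degree H dvd q ^ 3"
  proof -
    have "q ^ 3 = q\<^sup>2 * q" by (simp add: power3_eq_cube power2_eq_square)
    also have "\<dots> = degree H * p ^ b" unfolding degree_H by (subst (2) q_eq_d) (simp add: mult_ac)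
    finally show ?thesis by simp
  qed
  ultimately show ?thesis
    unfolding m_def using coprime_divisors[of "degree H" "q ^ 3" "q ^ n + 1" "q ^ n + 1"] by simp
qed

text \<open>The equation \<open>z ^ M = - y s\<close> makes \<open>y\<close> redundant, which turns the curve into a Kummer extension.\<close>

lemma adjoin_x_z: "adjoin emb {x, z} = UNIV"
proof -
  let ?E = "adjoin emb {x, z}"
  have E: "is_subfield ?E" by (rule is_subfield_adjoin)
  have sub: "range emb \<subseteq> ?E" "x \<in> ?E" "z \<in> ?E" using adjoin_superset[of "{x, z}"] by auto
  have "ev x s \<in> ?E" using sub by (intro ev_in_subring is_subfield_subring E) auto
  moreover have "z ^ M \<in> ?E" using sub by (intro subring_power is_subfield_subring E)
  moreover have "y = - (z ^ M * inverse (ev x s))" using z_pow_M s_nz by simp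
  ultimately have "y \<in> ?E"
    using E subring_uminus[OF is_subfield_subring[OF E]] subring_mult[OF is_subfield_subring[OF E]]
    by (simp add: is_subfield_def)
  then have "adjoin emb {x, y, z} \<subseteq> ?E" using sub E by (intro adjoin_minimal) auto
  then show ?thesis using generated by auto
qed

end

section \<open>Values on the curve\<close>

locale pointed_curve_X = curve_X +
  fixes P_inf :: "'b \<Rightarrow> int"
  assumes P_inf: "point emb P_inf" "P_inf x < 0"
begin

sublocale kummer: kummer_extension emb x z m H P_inf
  by standard
    (rule m_pos H_nz z_pow_m adjoin_x_z P_inf coprime_degree_H card_roots_m | simp add: of_nat_m)+

lemma value_z_ts:
  assumes "point emb P"
  shows "int m * P z = P (ev x t) + int (q + 1) * P (ev x s)"
proof -
  interpret place emb P by standard (rule assms)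
  have "P (ev x H) = P (ev x t) + int (q + 1) * P (ev x s)"
    using t_nz s_nz c_nz
    by (simp add: H_def ev_smult ev_mult ev_power value_mult value_power del: power_Suc of_nat_Suc)
  then show ?thesis using kummer.value_z[OF assms] by simp
qed

lemma value_s_eq_0:
  assumes "point emb P" "0 < P (ev x t)"
  shows "P (ev x s) = 0"
proof -
  interpret place emb P by standard (rule assms)
  have "0 < int (q - 1) * P (ev x t)" using assms(2) q_ge_2 by simp
  then have "0 < P (ev x t ^ (q - 1))" using t_nz by (simp only: value_power ev_eq_0_iff not_False_eq_True)
  then have "P (1 + ev x t ^ (q - 1)) = 0"
    using value_add_eq[of 1 "ev x t ^ (q - 1)"] by simp
  then show ?thesis by (simp add: s_def ev_add ev_power add.commute)
qed

text \<open>
  A totally ramified place other than \<open>P_inf\<close> has a finite \<open>x\<close>-coordinate and is invariant under the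
  Galois group, which multiplies \<open>y\<close> by the \<open>(q + 1)\<close>-th roots of unity \<open>\<zeta> ^ M\<close>.  If \<open>y\<close> took a value
  \<open>k \<noteq> 0\<close> at a rational such place, then \<open>\<zeta> ^ M y\<close> would take the same value \<open>k\<close>, which is absurd for
  \<open>\<zeta> ^ M \<noteq> 1\<close>.  Hence \<open>y\<close>, and with it \<open>t\<close>, vanishes.
\<close>

lemma ramified_point_zero_t:
  assumes P: "rational_point emb P" "totally_ramified q n emb x P" "P \<noteq> P_inf"
  shows "0 \<le> P x" "0 < P (ev x t)"
proof -
  have pt: "point emb P" using P by (simp add: rational_point_def)
  interpret place emb P by standard (rule pt)
  have ram: "has_ramification_index emb (adjoin emb {x}) P m"
    using P(2) by (simp add: totally_ramified_def m_def)
  show Px: "0 \<le> P x"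
    using kummer.ramified_pole_unique[OF pt ram] P(3) by fastforce
  have "int (q + 1) * P y = P (emb c * y ^ (q + 1))"
    using y_nz c_nz by (simp add: value_mult value_power del: power_Suc of_nat_Suc)
  then have Py: "int (q + 1) * P y = P (ev x t)" by (simp only: eq_y ev_t)
  show "0 < P (ev x t)"
  proof (rule ccontr)
    assume "\<not> 0 < P (ev x t)"
    then have "P (ev x t) = 0" using value_poly_nonneg[OF pt Px, of t] by simp
    then have "P y = 0" using Py by simp
    have "card {\<zeta>::'a. \<zeta> ^ M = 1} < card {\<zeta>::'a. \<zeta> ^ m = 1}"
      using card_power_eq_le(2)[OF M_pos, of "1::'a"] M_less by (simp add: card_roots_m)
    then have "\<not> {\<zeta>::'a. \<zeta> ^ m = 1} \<subseteq> {\<zeta>. \<zeta> ^ M = 1}"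
      using card_mono[OF card_power_eq_le(1)[OF M_pos, of "1::'a"]] by (meson not_le)
    then obtain \<zeta> :: 'a where \<zeta>: "\<zeta> ^ m = 1" "\<zeta> ^ M \<noteq> 1" by blast
    note twist = kummer.twist_mult[OF \<zeta>(1)] kummer.twist_diff[OF \<zeta>(1)] kummer.twist_emb[OF \<zeta>(1)]
      kummer.twist_power[OF \<zeta>(1)] kummer.twist_z[OF \<zeta>(1)]
    have "kummer.twist \<zeta> (z ^ M) = - (kummer.twist \<zeta> y * ev x s)"
      using kummer.twist_ratfun[OF \<zeta>(1), of "Fract s 1"] kummer.twist_diff[OF \<zeta>(1), of 0 "y * ev x s"]
      by (simp add: z_pow_M twist(1) kummer.twist_zero[OF \<zeta>(1)] ratfun_poly)
    moreover have "kummer.twist \<zeta> (z ^ M) = emb (\<zeta> ^ M) * z ^ M"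
      by (simp only: twist(4,5) power_mult_distrib emb_power)
    then have "kummer.twist \<zeta> (z ^ M) = emb (\<zeta> ^ M) * (- y * ev x s)"
      by (simp only: z_pow_M)
    ultimately have "(kummer.twist \<zeta> y - emb (\<zeta> ^ M) * y) * ev x s = 0"
      by (auto simp: algebra_simps)
    then have twist_y: "kummer.twist \<zeta> y = emb (\<zeta> ^ M) * y" using s_nz by simp
    have "\<exists>k. y = emb k \<or> 0 < P (y - emb k)"
      using P(1) y_nz \<open>P y = 0\<close> unfolding rational_point_def by (metis order_refl)
    then obtain k where k: "y = emb k \<or> 0 < P (y - emb k)" by blast
    have "k \<noteq> 0" using k y_nz \<open>P y = 0\<close> by auto
    show False
    proof (cases "y = emb k")
      case True
      then have "emb (\<zeta> ^ M) * y = y" using twist_y twist(3) by simp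
      then have "emb (\<zeta> ^ M) = emb 1" using y_nz by simp
      then show False using \<zeta>(2) by (simp only: emb_eq_iff)
    next
      case False
      then have pos: "0 < P (y - emb k)" using k by simp
      then have pos': "0 < P (emb (\<zeta> ^ M) * y - emb k)"
        using kummer.ramified_twist[OF pt ram \<zeta>(1), of "y - emb k"] by (simp add: twist(2,3) twist_y)
      define h where "h = emb (\<zeta> ^ M) * (y - emb k)"
      have "\<zeta> \<noteq> 0" using \<zeta>(1) m_pos by (auto simp: zero_power)
      then have h: "h \<noteq> 0" "0 < P h"
        using pos False by (auto simp: h_def value_mult)
      have diff: "h - (emb (\<zeta> ^ M) * y - emb k) = emb (k * (1 - \<zeta> ^ M))"
        by (simp add: h_def emb_mult emb_diff algebra_simps)
      have "k * (1 - \<zeta> ^ M) \<noteq> 0" using \<open>k \<noteq> 0\<close> \<zeta>(2) by simp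
      then have nz: "emb (k * (1 - \<zeta> ^ M)) \<noteq> 0" "P (emb (k * (1 - \<zeta> ^ M))) = 0"
        by (simp_all only: emb_eq_0_iff value_const not_False_eq_True)
      have "emb (\<zeta> ^ M) * y - emb k \<noteq> 0" using pos' by auto
      then have "min (P h) (P (emb (\<zeta> ^ M) * y - emb k)) \<le> P (emb (k * (1 - \<zeta> ^ M)))"
        using value_add[of h "- (emb (\<zeta> ^ M) * y - emb k)"] h(1) nz(1) diff
        by (simp only: value_uminus neg_equal_0_iff_equal simp_thms flip: diff_conv_add_uminus)
      then show False using h(2) pos' nz(2) by simp
    qed
  qed
qed

text \<open>
  The value of \<open>t\<close> is a multiple of \<open>m\<close>, the value of \<open>x - k\<close>, and divides it, because \<open>t s\<close> has only
  simple zeros; so it is \<open>m\<close>, and the equation of \<open>z\<close> shows that \<open>z\<close> is a local parameter.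
\<close>

lemma ramified_point_values:
  assumes P: "rational_point emb P" "totally_ramified q n emb x P" "P \<noteq> P_inf"
  obtains k where "P (x - emb k) = int m" "P z = 1"
proof -
  have pt: "point emb P" using P by (simp add: rational_point_def)
  interpret place emb P by standard (rule pt)
  have ram: "has_ramification_index emb (adjoin emb {x}) P m"
    using P(2) by (simp add: totally_ramified_def m_def)
  have Px: "0 \<le> P x" and t_pos: "0 < P (ev x t)" by (rule ramified_point_zero_t[OF P])+
  have s: "P (ev x s) = 0" by (rule value_s_eq_0[OF pt t_pos])
  have x_nz: "x - emb k \<noteq> 0" for k
    using ev_eq_0_iff[of "[:- k, 1:]"] by (auto simp: emb_uminus)
  have "x \<noteq> 0" using x_nz[of 0] by simp
  then have "\<exists>k. x = emb k \<or> 0 < P (x - emb k)"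
    using P(1) Px unfolding rational_point_def by blast
  then obtain k where k: "0 < P (x - emb k)" using x_nz by auto
  then have Pk: "P (x - emb k) = int m" by (rule kummer.ramified_value_linear[OF pt ram])
  have "int m dvd P (ev x t)"
    using value_poly_zero[OF pt k t_nz] Pk by simp
  moreover have ts: "P (ev x (t * s)) = P (ev x t)"
    using t_nz s_nz s by (simp add: ev_mult value_mult)
  then have "P (ev x (t * s)) dvd P (ratfun (Fract [:- k, 1:] 1))"
    using t_pos by (intro value_separable_dvd[OF pt Px pderiv_ts]) (simp_all add: Zero_fract_def eq_fract)
  then have "P (ev x t) dvd int m"
    using ts Pk by (simp add: ratfun_poly emb_uminus)
  ultimately have "P (ev x t) = int m" using t_pos by (simp add: zdvd_antisym_nonneg)
  then have "int m * P z = int m * 1" using value_z_ts[OF pt] s by simp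
  then have "P z = 1" using m_pos by simp
  then show ?thesis using that Pk by blast
qed

end

section \<open>Functions with extremal poles\<close>

context curve_X
begin

text \<open>
  The coefficients of the pure gap are \<open>\<sigma> w + \<alpha> m\<close> and \<open>(3 - \<sigma>) w + (q d - 3 - \<alpha>) m\<close>, where
  \<open>\<sigma> = \<beta> + 1\<close>.  Since \<open>(q + 1) w = m + q ^ (n - 3) - 1\<close>, it is slightly larger than
  \<open>M = m / (q + 1)\<close>.
\<close>

definition w :: int where
  "w = int q ^ (n - 3) * (int q ^ 2 - int q + 1)"

context
  assumes n_ge_5: "5 \<le> n"
begin

lemma m_eq: "int m = int q ^ 3 * int q ^ (n - 3) + 1"
  using n_ge_5 by (simp add: m_def flip: power_add)

lemma q_power_gt_1: "1 < int q ^ (n - 3)"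
  using n_ge_5 q_ge_2 by (intro one_less_power) auto

lemma w_eq: "(int q + 1) * w = int m + int q ^ (n - 3) - 1"
  by (simp add: w_def m_eq algebra_simps power2_eq_square power3_eq_cube)

lemma w_pos: "0 < w"
proof -
  have "0 < (int q + 1) * w" using w_eq q_power_gt_1 m_pos by simp
  then show ?thesis by (simp add: zero_less_mult_iff)
qed

lemma two_w_less_m: "2 * w < int m"
proof -
  \<comment> \<open>This product is \<open>q ^ 3 - 2 (q\<^sup>2 - q + 1) - 2\<close>.\<close>
  have "0 \<le> (int q - 2) * (int q ^ 2 + 2)" using q_ge_2 by simp
  then have "2 * (int q ^ 2 - int q + 1) \<le> int q ^ 3"
    by (simp add: algebra_simps power2_eq_square power3_eq_cube)
  then have "int q ^ (n - 3) * (2 * (int q ^ 2 - int q + 1)) \<le> int q ^ (n - 3) * int q ^ 3"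
    by (intro mult_left_mono) auto
  then show ?thesis by (simp add: w_def m_eq algebra_simps)
qed

text \<open>
  Up to a positive factor, this is a lower bound for the order of vanishing at infinity of the
  function \<open>G\<close> constructed in the next proof.  It is positive because \<open>b \<ge> 1\<close>, in the form \<open>2 d \<le> q\<close>.
\<close>

lemma infinity_margin: "0 < int m + int d * (int m * (int q - 1) - w * int q ^ 2)"
proof -
  define R where "R = int q ^ (n - 3)"
  have R: "1 < R" using q_power_gt_1 by (simp add: R_def)
  have "2 * (int d * (int m + int q ^ 2 * R - int q ^ 2)) \<le> int q * (int m + int q ^ 2 * R - int q ^ 2)"
  proof -
    have "int q ^ 2 * 1 \<le> int q ^ 2 * R" using R by (intro mult_left_mono) auto
    then have "0 \<le> int m + int q ^ 2 * R - int q ^ 2" by simp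
    moreover have "2 * int d \<le> int q" using two_d_le_q by linarith
    ultimately have "2 * int d * (int m + int q ^ 2 * R - int q ^ 2) \<le> int q * (int m + int q ^ 2 * R - int q ^ 2)"
      by (intro mult_right_mono)
    then show ?thesis by (simp add: mult.assoc)
  qed
  also have "\<dots> < 2 * (int m * (int q + 1))"
  proof -
    have m: "int m = int q ^ 3 * R + 1" using m_eq by (simp add: R_def)
    have "2 * (int m * (int q + 1)) - int q * (int m + int q ^ 2 * R - int q ^ 2) =
        int q + 2 + int q ^ 3 + int q ^ 3 * R * (int q + 1)"
      unfolding m by (simp add: algebra_simps power2_eq_square power3_eq_cube)
    moreover have "0 \<le> int q ^ 3 * R * (int q + 1)" "0 \<le> int q ^ 3" using R by simp_all
    ultimately show ?thesis by linarith
  qed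
  finally have "0 < int m * (int q + 1) - int d * (int m + int q ^ 2 * R - int q ^ 2)" by simp
  also have "\<dots> = int m * (int q + 1) + int d * (int m * (int q ^ 2 - 1) - ((int q + 1) * w) * int q ^ 2)"
    unfolding w_eq R_def by (simp add: algebra_simps)
  also have "\<dots> = (int q + 1) * (int m + int d * (int m * (int q - 1) - w * int q ^ 2))"
    by (simp add: algebra_simps power2_eq_square)
  finally show ?thesis by (simp add: zero_less_mult_iff)
qed

end

end

text \<open>
  If a function \<open>f\<close> attains the pole order \<open>\<sigma> w + \<alpha> m\<close> at \<open>P1\<close>, then so does a monomial component
  \<open>g z ^ j\<close> of \<open>f\<close>, and the exponent \<open>j\<close> is determined modulo \<open>m\<close>.  The bounds at all the finite
  places determine how many powers of \<open>x - k1\<close>, \<open>x - k2\<close> and \<open>s\<close> are needed to make \<open>g\<close> a polynomial.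
  But the product \<open>G\<close> of \<open>g\<close> with these powers vanishes at infinity, which a nonzero polynomial does
  not.
\<close>

lemma (in pointed_curve_X) no_extremal_function:
  assumes n_ge_5: "5 \<le> n"
    and P1: "rational_point emb P1" "totally_ramified q n emb x P1" "P1 \<noteq> P_inf"
    and P2: "rational_point emb P2" "totally_ramified q n emb x P2" "P2 \<noteq> P_inf"
    and "P1 \<noteq> P2"
    and \<sigma>: "\<sigma> \<in> {1, 2}" and \<alpha>: "0 \<le> \<alpha>" "\<alpha> \<le> int q * int d - 3"
    and "f \<noteq> 0"
    and f1: "P1 f = - (\<sigma> * w + \<alpha> * int m)"
    and f2: "- ((3 - \<sigma>) * w + (int q * int d - 3 - \<alpha>) * int m) \<le> P2 f"
    and f3: "\<And>P. point emb P \<Longrightarrow> P \<noteq> P1 \<Longrightarrow> P \<noteq> P2 \<Longrightarrow> 0 \<le> P f"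
  shows False
proof -
  have pt1: "point emb P1" and pt2: "point emb P2"
    using P1 P2 by (auto simp: rational_point_def)
  interpret P1: place emb P1 by standard (rule pt1)
  interpret P2: place emb P2 by standard (rule pt2)
  have ram1: "has_ramification_index emb (adjoin emb {x}) P1 m"
    and ram2: "has_ramification_index emb (adjoin emb {x}) P2 m"
    using P1 P2 by (simp_all add: totally_ramified_def m_def)
  obtain k1 where k1: "P1 (x - emb k1) = int m" "P1 z = 1"
    by (rule ramified_point_values[OF P1])
  obtain k2 where k2: "P2 (x - emb k2) = int m" "P2 z = 1"
    by (rule ramified_point_values[OF P2])
  define D where "D P = (if P = P1 then \<sigma> * w + \<alpha> * int m else if P = P2
      then (3 - \<sigma>) * w + (int q * int d - 3 - \<alpha>) * int m else 0)" for P
  have D: "- D P \<le> P f" if "point emb P" for P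
    using f1 f2 f3[OF that] by (auto simp: D_def)
  \<comment> \<open>The divisor is invariant under the Galois group, because \<open>P1\<close> and \<open>P2\<close> are.\<close>
  have twist_ram: "(\<lambda>f. P (kummer.twist \<zeta> f)) = Q \<longleftrightarrow> P = Q"
    if "point emb Q" "has_ramification_index emb (adjoin emb {x}) Q m" "\<zeta> ^ m = 1" for P Q \<zeta>
  proof
    assume eq: "(\<lambda>f. P (kummer.twist \<zeta> f)) = Q"
    have inv: "inverse \<zeta> ^ m = 1" using that by (simp add: power_inverse)
    have "P h = Q h" for h
    proof -
      have "P h = P (kummer.twist \<zeta> (kummer.twist (inverse \<zeta>) h))"
        using kummer.twist_inverse[OF that(3)] by simp
      also have "\<dots> = Q (kummer.twist (inverse \<zeta>) h)" using fun_cong[OF eq] .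
      also have "\<dots> = Q h" by (rule kummer.ramified_twist[OF that(1,2) inv])
      finally show ?thesis .
    qed
    then show "P = Q" by (rule ext)
  qed (use kummer.ramified_twist[OF that] in auto)
  obtain c where c: "f = (\<Sum>i<m. ratfun (c i) * z ^ i)" by (rule kummer.monomials_span)
  have component: "- D P \<le> P (ratfun (c i) * z ^ i)" if "point emb P" "i < m" "c i \<noteq> 0" for P i
  proof (rule kummer.component_value_ge[OF that(1) c])
    fix \<zeta> :: 'a assume \<zeta>: "\<zeta> ^ m = 1"
    have "D (\<lambda>f. P (kummer.twist \<zeta> f)) = D P"
      unfolding D_def twist_ram[OF pt1 ram1 \<zeta>] twist_ram[OF pt2 ram2 \<zeta>] ..
    then show "- D P \<le> P (kummer.twist \<zeta> f)"
      using D[OF kummer.point_twist[OF that(1) \<zeta>]] by simp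
  qed (use that \<open>f \<noteq> 0\<close> in auto)

  have value1: "P1 (ratfun g * z ^ i) = P1 (ratfun g) + int i" if "g \<noteq> 0" for g i
    using that kummer.z_nz k1(2) by (simp add: P1.value_mult P1.value_power)
  have dvd1: "int m dvd P1 (ratfun g)" for g by (rule kummer.ramified_values(1)[OF ram1])
  note distinct = kummer.ramified_distinct_values[OF pt1 dvd1 kummer.z_nz k1(2)]
  obtain i0 where i0: "i0 < m" "c i0 \<noteq> 0"
  proof (rule ccontr)
    assume "\<not> thesis"
    then have "\<forall>i<m. c i = 0" using that by blast
    then show False using c \<open>f \<noteq> 0\<close> by simp
  qed
  obtain j where "j \<in> {..<m}" "ratfun (c j) * z ^ j \<noteq> 0"
    and "P1 (\<Sum>i<m. ratfun (c i) * z ^ i) = P1 (ratfun (c j) * z ^ j)"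
    by (rule P1.value_sum_distinct[of "{..<m}" i0 "\<lambda>i. ratfun (c i) * z ^ i"])
      (use i0 kummer.z_nz distinct in auto)
  then have j: "j < m" "c j \<noteq> 0" "P1 f = P1 (ratfun (c j)) + int j"
    using value1 by (auto simp flip: c)
  define g where "g = c j"
  have "g \<noteq> 0" using j by (simp add: g_def)
  have \<sigma>w: "0 < \<sigma> * w" "\<sigma> * w < int m"
    using \<sigma> w_pos[OF n_ge_5] two_w_less_m[OF n_ge_5] by auto
  have exponent: "int j = int m - \<sigma> * w" "P1 (ratfun g) = - (\<alpha> + 1) * int m"
  proof -
    have eq: "P1 (ratfun g) = - (\<sigma> * w + \<alpha> * int m) - int j" using j f1 by (simp add: g_def)
    have "int m dvd P1 (ratfun g) + \<alpha> * int m" using dvd1 by simp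
    then have "int m dvd - (\<sigma> * w + int j)" unfolding eq by (simp add: algebra_simps)
    then have "int m dvd \<sigma> * w + int j" by (simp only: dvd_minus_iff)
    then obtain l where l: "\<sigma> * w + int j = int m * l" by auto
    have "0 < int m * l" "int m * l < int m * 2" using \<sigma>w j(1) l by linarith+
    then have "0 < l" "l < 2" using m_pos by (auto simp: zero_less_mult_iff)
    then have "l = 1" by simp
    then show "int j = int m - \<sigma> * w" using l by simp
    then show "P1 (ratfun g) = - (\<alpha> + 1) * int m" using eq by (simp add: algebra_simps)
  qed
  define \<kappa> where "\<kappa> = int q * int d - 1 - \<sigma> - \<alpha>"
  have \<kappa>: "0 \<le> \<kappa>" using \<sigma> \<alpha> by (auto simp: \<kappa>_def)
  have value2: "- \<kappa> * int m \<le> P2 (ratfun g)"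
  proof -
    have "P2 (ratfun g * z ^ j) = P2 (ratfun g) + int j"
      using \<open>g \<noteq> 0\<close> kummer.z_nz k2(2) by (simp add: P2.value_mult P2.value_power)
    then have ge: "- ((3 - \<sigma>) * w + (int q * int d - 3 - \<alpha>) * int m) - int j \<le> P2 (ratfun g)"
      using component[OF pt2 j(1,2)] \<open>P1 \<noteq> P2\<close> by (auto simp: D_def g_def)
    obtain v where v: "P2 (ratfun g) = int m * v"
      using kummer.ramified_values(1)[OF ram2, of g] by (auto elim: dvdE)
    have "int m * (- \<kappa> - 1) < - ((3 - \<sigma>) * w + (int q * int d - 3 - \<alpha>) * int m) - int j"
      using \<sigma> w_pos[OF n_ge_5] two_w_less_m[OF n_ge_5] unfolding exponent \<kappa>_def
      by (auto simp: algebra_simps)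
    then have "int m * (- \<kappa> - 1) < int m * v" using ge v by simp
    then have "- \<kappa> - 1 < v" using m_pos by simp
    then have "int m * (- \<kappa>) \<le> int m * v" by (intro mult_left_mono) auto
    then show ?thesis using v by (simp add: mult.commute)
  qed

  define L where "L = [:- k1, 1:] ^ nat (\<alpha> + 1) * [:- k2, 1:] ^ nat \<kappa> * s ^ nat (int q - \<sigma>)"
  have "L \<noteq> 0" using s_nz by (simp add: L_def)
  have q\<sigma>: "0 \<le> int q - \<sigma>" using \<sigma> q_ge_2 by auto
  have x_nz: "x - emb k \<noteq> 0" for k
    using ev_eq_0_iff[of "[:- k, 1:]"] by (auto simp: emb_uminus)
  have value_L: "P (ev x L) = (\<alpha> + 1) * P (x - emb k1) + \<kappa> * P (x - emb k2) + (int q - \<sigma>) * P (ev x s)"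
    if "point emb P" for P
  proof -
    interpret place emb P by standard (rule that)
    have "ev x L = (x - emb k1) ^ nat (\<alpha> + 1) * (x - emb k2) ^ nat \<kappa> * ev x s ^ nat (int q - \<sigma>)"
      by (simp add: L_def ev_mult ev_power emb_uminus)
    then show ?thesis
      using x_nz[of k1] x_nz[of k2] s_nz \<alpha> \<kappa> q\<sigma> by (simp add: value_mult value_power)
  qed
  define G where "G = g * Fract L 1"
  have "Fract L 1 \<noteq> 0" using \<open>L \<noteq> 0\<close> by (simp add: Zero_fract_def eq_fract)
  then have "G \<noteq> 0" using \<open>g \<noteq> 0\<close> by (simp add: G_def)
  have value_G: "P (ratfun G) = P (ratfun g) + P (ev x L)" if "point emb P" for P
  proof -
    interpret place emb P by standard (rule that)
    show ?thesis
      using \<open>g \<noteq> 0\<close> \<open>L \<noteq> 0\<close> by (simp add: G_def K.emb_mult ratfun_poly value_mult)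
  qed
  have finite: "0 \<le> P (ratfun G)" if pt: "point emb P" and Px: "0 \<le> P x" for P
  proof -
    interpret place emb P by standard (rule pt)
    have nonneg: "0 \<le> P (x - emb k1)" "0 \<le> P (x - emb k2)" "0 \<le> P (ev x s)" "0 \<le> P (ev x t)"
      using value_poly_nonneg[OF pt Px, of "[:- k1, 1:]"] value_poly_nonneg[OF pt Px, of "[:- k2, 1:]"]
        value_poly_nonneg[OF pt Px] by (auto simp: emb_uminus)
    have products: "0 \<le> (\<alpha> + 1) * P (x - emb k1)" "0 \<le> \<kappa> * P (x - emb k2)"
        "0 \<le> (int q - \<sigma>) * P (ev x s)"
      using nonneg \<alpha> \<kappa> q\<sigma> by simp_all
    consider "P = P1" | "P = P2" | "P \<noteq> P1" "P \<noteq> P2" by blast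
    then show ?thesis
    proof cases
      case 1
      then have "(\<alpha> + 1) * int m \<le> P (ev x L)" using value_L[OF pt] products k1 by simp
      then show ?thesis using value_G[OF pt] exponent 1 by (simp add: algebra_simps)
    next
      case 2
      then have "\<kappa> * int m \<le> P (ev x L)" using value_L[OF pt] products k2 by simp
      then show ?thesis using value_G[OF pt] value2 2 by (simp add: algebra_simps)
    next
      case 3
      then have "0 \<le> P (ratfun g * z ^ j)" using component[OF pt j(1,2)] by (simp add: D_def g_def)
      then have g: "- int j * P z \<le> P (ratfun g)"
        using \<open>g \<noteq> 0\<close> kummer.z_nz by (simp add: value_mult value_power)
      have L_ge: "(int q - \<sigma>) * P (ev x s) \<le> P (ev x L)"
        using value_L[OF pt] products by simp
      have zv: "int m * P z = P (ev x t) + int (q + 1) * P (ev x s)" by (rule value_z_ts[OF pt])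
      have ts: "P (ev x (t * s)) = P (ev x t) + P (ev x s)"
        using t_nz s_nz by (simp add: ev_mult value_mult)
      \<comment> \<open>It suffices to exceed \<open>- P (ev x (t * s))\<close>, which divides the value of \<open>G\<close>.\<close>
      have integrality: "0 \<le> P (ratfun G)"
        if pos: "0 < P (ev x (t * s))" and gt: "- P (ev x (t * s)) < P (ratfun G)"
      proof -
        obtain l where l: "P (ratfun G) = P (ev x (t * s)) * l"
          using value_separable_dvd[OF pt Px pderiv_ts pos \<open>G \<noteq> 0\<close>] by (auto elim: dvdE)
        then have "P (ev x (t * s)) * (- 1) < P (ev x (t * s)) * l" using gt by simp
        then have "- 1 < l" using pos by (simp only: mult_less_cancel_left_pos)
        then show ?thesis using l pos by simp
      qed
      consider "0 < P (ev x t)" | "P (ev x t) = 0" "0 < P (ev x s)"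
        | "P (ev x t) = 0" "P (ev x s) = 0" using nonneg by linarith
      then show ?thesis
      proof cases
        case 1
        have s0: "P (ev x s) = 0" by (rule value_s_eq_0[OF pt 1])
        then have Pz: "int m * P z = P (ev x t)" using zv by simp
        then have "0 < P z" using 1 m_pos by (metis of_nat_0_le_iff zero_less_mult_pos of_nat_0_less_iff)
        then have "int j * P z < int m * P z" using j(1) by simp
        then have "- P (ev x t) < P (ratfun G)"
          using g L_ge value_G[OF pt] s0 Pz by simp
        then show ?thesis using integrality ts s0 1 by simp
      next
        case 2
        have MP: "int M * P z = P (ev x s)"
        proof -
          have "int (q + 1) * (int M * P z) = int (q + 1) * P (ev x s)"
            using zv 2(1) by (simp flip: M_eq add: algebra_simps)
          then show ?thesis by (simp del: of_nat_Suc)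
        qed
        then have "0 < P z" using 2(2) M_pos by (metis of_nat_0_less_iff zero_less_mult_pos)
        \<comment> \<open>Here \<open>n \<ge> 5\<close> matters: it makes \<open>w\<close> strictly larger than \<open>M\<close>.\<close>
        have jM: "int j < (int q - \<sigma> + 1) * int M"
        proof -
          have "0 < \<sigma> * (int q ^ (n - 3) - 1)" using \<sigma> q_power_gt_1[OF n_ge_5] by auto
          moreover have "(int q + 1) * int j = (int q + 1) * int m - \<sigma> * ((int q + 1) * w)"
            unfolding exponent by (simp add: algebra_simps)
          moreover have "(int q + 1) * ((int q - \<sigma> + 1) * int M) = (int q - \<sigma> + 1) * int m"
            by (simp flip: M_eq add: algebra_simps)
          ultimately have "(int q + 1) * int j < (int q + 1) * ((int q - \<sigma> + 1) * int M)"
            unfolding w_eq[OF n_ge_5] by (simp add: algebra_simps)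
          then show ?thesis by (simp add: mult_less_cancel_left)
        qed
        then have "int j * P z < (int q - \<sigma> + 1) * int M * P z"
          using \<open>0 < P z\<close> by simp
        then have "int j * P z < (int q - \<sigma> + 1) * P (ev x s)" by (simp add: MP mult.assoc)
        then have "- P (ev x s) < P (ratfun G)"
          using g L_ge value_G[OF pt] by (simp add: algebra_simps)
        then show ?thesis using integrality ts 2 by simp
      next
        case 3
        then have "P z = 0" using zv m_pos by simp
        then show ?thesis using g L_ge value_G[OF pt] 3 by simp
      qed
    qed
  qed
  obtain r where r: "ratfun G = ev x r"
    by (rule ratfun_poly_of_nonneg[where m = m and g = G])
      (rule kummer.algebraic, rule finite, assumption+)
  then have "r \<noteq> 0" using \<open>G \<noteq> 0\<close> by auto
  then have "P_inf (ratfun G) \<le> 0"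
    using value_poly_pole[OF P_inf \<open>r \<noteq> 0\<close>] P_inf(2) r by (simp add: mult_nonneg_nonpos)
  moreover have "0 < P_inf (ratfun G)"
  proof -
    interpret P_inf: place emb P_inf by standard (rule P_inf)
    define e where "e = - P_inf x"
    have e: "0 < e" using P_inf(2) by (simp add: e_def)
    have "0 \<le> P_inf (ratfun g * z ^ j)"
      using component[OF P_inf(1) j(1,2)] P1(3) P2(3) by (simp add: D_def g_def)
    then have g: "- int j * P_inf z \<le> P_inf (ratfun g)"
      using \<open>g \<noteq> 0\<close> kummer.z_nz by (simp add: P_inf.value_mult P_inf.value_power)
    have lin: "P_inf (x - emb k) = - e" for k
      using value_poly_pole[OF P_inf, of "[:- k, 1:]"] by (simp add: emb_uminus e_def)
    have vs: "P_inf (ev x s) = - (int q - 1) * int d * e"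
      using value_poly_pole[OF P_inf s_nz] q_ge_2 by (simp add: degree_s e_def of_nat_diff algebra_simps)
    have L: "P_inf (ev x L) = - e * ((\<alpha> + 1) + \<kappa> + (int q - \<sigma>) * (int q - 1) * int d)"
      unfolding value_L[OF P_inf(1)] lin vs by (simp add: algebra_simps)
    have z: "int m * P_inf z = - e * (int q ^ 2 * int d)"
      using kummer.value_z[OF P_inf(1)] value_poly_pole[OF P_inf H_nz]
      by (simp add: degree_H e_def algebra_simps)
    have "0 < e * \<sigma> * (int m + int d * (int m * (int q - 1) - w * int q ^ 2))"
      using e \<sigma> infinity_margin[OF n_ge_5] by (intro mult_pos_pos) auto
    also have "\<dots> = - int j * (- e * (int q ^ 2 * int d)) + int m * P_inf (ev x L)"
      unfolding L exponent \<kappa>_def by (simp add: algebra_simps power2_eq_square)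
    also have "\<dots> = int m * (- int j * P_inf z + P_inf (ev x L))"
      unfolding z[symmetric] by (simp add: algebra_simps)
    also have "\<dots> \<le> int m * P_inf (ratfun G)"
      using g value_G[OF P_inf(1)] by (intro mult_left_mono) auto
    finally show ?thesis by (simp add: zero_less_mult_iff)
  qed
  ultimately show False by simp
qed

section \<open>The pure gap\<close>

theorem proposition6p8:
  fixes p a b q n n1 n2 :: nat
    and \<alpha> \<beta> :: int
    and emb :: "'k::field \<Rightarrow> 'f::field"
    and c :: 'k
    and x y z :: 'f
    and P_inf P1 P2 :: "'f \<Rightarrow> int"
  assumes "curve_X p a b q n emb c x y z"
    and "common_pole emb x y z P_inf"
    and "rational_point emb P1" and "totally_ramified q n emb x P1" and "P1 \<noteq> P_inf"
    and "rational_point emb P2" and "totally_ramified q n emb x P2" and "P2 \<noteq> P_inf"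
    and "P1 \<noteq> P2"
    and "\<alpha> \<in> {0 .. int q ^ 2 div int p ^ b - 3}"
    and "\<beta> \<in> {0, 1}"
    and "n \<ge> 5"
    and "int n1 = (\<beta> + 1) * int q ^ (n - 3) * (int q ^ 2 - int q + 1) + \<alpha> * (int q ^ n + 1)"
    and "int n2 = (int q ^ 2 div int p ^ b - 3) * (int q ^ n + 1)
                  + 3 * int q ^ (n - 3) * (int q ^ 2 - int q + 1)
                  - (\<beta> + 1) * int q ^ (n - 3) * (int q ^ 2 - int q + 1)
                  - \<alpha> * (int q ^ n + 1)"
  shows "pure_gap emb [n1, n2] [P1, P2]"
proof -
  interpret pointed_curve_X p a b q n emb c x y z P_inf
    using assms(1,2) by (simp add: pointed_curve_X_def pointed_curve_X_axioms_def common_pole_def)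
  have Q: "int q ^ 2 div int p ^ b = int q * int d"
  proof -
    have "int q ^ 2 = int q * int d * int p ^ b"
      by (simp add: power2_eq_square) (simp add: q_eq_d)
    then show ?thesis using p_ge_2 by simp
  qed
  have m: "int q ^ n + 1 = int m" by (simp add: m_def)
  define D where "D = divisor_of [n1, n2] [P1, P2]"
  have D: "Poly_Mapping.lookup D P = (if P = P1 then int n1 else if P = P2 then int n2 else 0)" for P
    using \<open>P1 \<noteq> P2\<close>
    by (simp add: D_def divisor_of_def numeral_2_eq_2 lookup_add lookup_single when_def)
  have n1: "int n1 = (\<beta> + 1) * w + \<alpha> * int m"
    using assms(13) unfolding m by (simp add: w_def mult.assoc)
  have n2: "int n2 = (3 - (\<beta> + 1)) * w + (int q * int d - 3 - \<alpha>) * int m"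
    using assms(14) unfolding m Q by (simp add: w_def algebra_simps)
  \<comment> \<open>Equality of the dimensions holds because the spaces themselves coincide.\<close>
  have bounds: "f = 0 \<or> (- int n1 < P1 f \<and> - int n2 < P2 f)" if "f \<in> riemann_roch_space emb D" for f
  proof (rule disjCI)
    assume not_less: "\<not> (- int n1 < P1 f \<and> - int n2 < P2 f)"
    show "f = 0"
    proof (rule ccontr)
      assume "f \<noteq> 0"
      then have ge: "- Poly_Mapping.lookup D P \<le> P f" if "point emb P" for P
        using \<open>f \<in> _\<close> that by (auto simp: riemann_roch_space_def)
      have f1: "- int n1 \<le> P1 f" and f2: "- int n2 \<le> P2 f"
        using ge[of P1] ge[of P2] assms(3,6) \<open>P1 \<noteq> P2\<close> by (auto simp: D rational_point_def)
      have f3: "0 \<le> P f" if "point emb P" "P \<noteq> P1" "P \<noteq> P2" for P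
        using ge[OF that(1)] that by (simp add: D)
      consider "P1 f = - int n1" | "P2 f = - int n2"
        using f1 f2 not_less by fastforce
      then show False
      proof cases
        case 1
        show False
          by (rule no_extremal_function[OF assms(12) assms(3-9), of "\<beta> + 1" \<alpha> f])
            (use assms(10,11) Q \<open>f \<noteq> 0\<close> 1 f2 f3 n1 n2 in auto)
      next
        case 2
        \<comment> \<open>The two points and their coefficients are exchanged by \<open>\<beta> \<mapsto> 1 - \<beta>\<close> and a reflection of \<open>\<alpha>\<close>.\<close>
        show False
        proof (rule no_extremal_function[OF assms(12) assms(6-8) assms(3-5) assms(9)[symmetric],
            of "2 - \<beta>" "int q * int d - 3 - \<alpha>" f])
          show "P2 f = - ((2 - \<beta>) * w + (int q * int d - 3 - \<alpha>) * int m)"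
            using 2 n2 by simp
          show "- ((3 - (2 - \<beta>)) * w + (int q * int d - 3 - (int q * int d - 3 - \<alpha>)) * int m) \<le> P1 f"
            using f1 n1 by (simp add: algebra_simps)
        qed (use assms(10,11) Q \<open>f \<noteq> 0\<close> f3 in auto)
      qed
    qed
  qed
  have "riemann_roch_space emb (D - Poly_Mapping.single P 1) = riemann_roch_space emb D"
    if "P \<in> {P1, P2}" for P
  proof
    show "riemann_roch_space emb (D - Poly_Mapping.single P 1) \<subseteq> riemann_roch_space emb D"
      by (fastforce simp: riemann_roch_space_def lookup_minus lookup_single when_def split: if_splits)
    show "riemann_roch_space emb D \<subseteq> riemann_roch_space emb (D - Poly_Mapping.single P 1)"
    proof
      fix f assume f: "f \<in> riemann_roch_space emb D"
      have "- Poly_Mapping.lookup (D - Poly_Mapping.single P 1) P' \<le> P' f"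
        if "f \<noteq> 0" "point emb P'" for P'
      proof (cases "P' = P")
        case True
        then show ?thesis
          using bounds[OF f] \<open>f \<noteq> 0\<close> \<open>P \<in> _\<close> \<open>P1 \<noteq> P2\<close>
          by (auto simp: lookup_minus lookup_single D)
      next
        case False
        then show ?thesis
          using f that by (auto simp: riemann_roch_space_def lookup_minus lookup_single when_def)
      qed
      then show "f \<in> riemann_roch_space emb (D - Poly_Mapping.single P 1)"
        by (auto simp: riemann_roch_space_def)
    qed
  qed
  then have "ell emb (D - Poly_Mapping.single P 1) = ell emb D" if "P \<in> {P1, P2}" for P
    using that by (simp add: ell_def)
  then show ?thesis
    using assms(3,6,9) by (auto simp: pure_gap_def less_2_cases_iff numeral_2_eq_2 less_Suc_eq simp flip: D_def)
qed

end
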